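(* Let $B_n$ be the braid group on $n$ strands and let $x\in B_n$ with canonical length $\ell(x)>1$. Then $x$ is conjugate (in $B_n$) to a left rigid braid if and only if $x$ is conjugate to a right rigid braid.
   Context: $B_n$ is the braid group with standard (Artin) generators $\sigma_1,\dots,\sigma_{n-1}$; $B_n^+$ is the submonoid generated by $\sigma_1,\dots,\sigma_{n-1}$ (positive braids); $\Delta=\sigma_1(\sigma_2\sigma_1)\cdots(\sigma_{n-1}\cdots\sigma_1)$. Write $a\preccurlyeq b$ if $a^{-1}b\in B_n^+$ and $a\succcurlyeq b$ if $ab^{-1}\in B_n^+$; both are lattice orders, with gcd's $\wedge_L$ (for $\preccurlyeq$) and $\wedge_R$ (for $\succcurlyeq$). Simple braids are the $s$ with $1\preccurlyeq s\preccurlyeq\Delta$. Put $\tau(g)=\Delta^{-1}g\Delta$. Left normal form of $x$: the unique decomposition $x=\Delta^p x_1\cdots x_r$ with $p$ maximal such that $\Delta^{-p}x$ is positive and $x_i=(x_i\cdots x_r)\wedge_L\Delta\ne1$ for all $i$. Right normal form of $x$: the unique decomposition $x=y_1\cdots y_r\Delta^p$ with $p$ maximal such that $x\Delta^{-p}$ is positive and $y_i=(y_1\cdots y_i)\wedge_R\Delta\neq1$ for all $i$. The integers $p,r$ are the same for both; $\inf(x)=p$, $\sup(x)=p+r$, and the canonical length is $\ell(x)=r$. If $r>0$, $\iota_L(x)=\tau^{-p}(x_1)$ and $\iota_R(x)=\tau^{p}(y_r)$. $x$ is left rigid if $r>0$ and $\Delta^p x_1\cdots x_r\,\iota_L(x)$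 is in left normal form as written; $x$ is right rigid if $r>0$ and $\iota_R(x)\,y_1\cdots y_r\Delta^p$ is in right normal form as written. *)

theory Defs
  imports "HOL-Algebra.Group" "HOL-Algebra.Lattice"
begin

section \<open>The braid group\<close>

text \<open>The letter \<open>(True, i)\<close> stands for the Artin generator \<open>\<sigma>\<^sub>i\<close>, the letter \<open>(False, i)\<close>
  for its inverse. The parameter \<open>n\<close> is the number of strands throughout.\<close>

type_synonym braid_word = "(bool \<times> nat) list"

definition braid_words :: "nat \<Rightarrow> braid_word set" where
  "braid_words n = lists (UNIV \<times> {1..<n})"

inductive braid_eq :: "nat \<Rightarrow> braid_word \<Rightarrow> braid_word \<Rightarrow> bool" for n where
  refl: "w \<in> braid_words n \<Longrightarrow> braid_eq n w w"
| sym: "braid_eq n u v \<Longrightarrow> braid_eq n v u"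
| trans: "braid_eq n u v \<Longrightarrow> braid_eq n v w \<Longrightarrow> braid_eq n u w"
| append: "braid_eq n u v \<Longrightarrow> a \<in> braid_words n \<Longrightarrow> b \<in> braid_words n
    \<Longrightarrow> braid_eq n (a @ u @ b) (a @ v @ b)"
| cancel: "i \<in> {1..<n} \<Longrightarrow> braid_eq n [(e, i), (\<not> e, i)] []"
| far: "i \<in> {1..<n} \<Longrightarrow> j \<in> {1..<n} \<Longrightarrow> i + 2 \<le> j
    \<Longrightarrow> braid_eq n [(True, i), (True, j)] [(True, j), (True, i)]"
| braid: "i \<in> {1..<n} \<Longrightarrow> i + 1 \<in> {1..<n}
    \<Longrightarrow> braid_eq n [(True, i), (True, i + 1), (True, i)] [(True, i + 1), (True, i), (True, i + 1)]"

definition braid_class :: "nat \<Rightarrow> braid_word \<Rightarrow> braid_word set" where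
  "braid_class n w = {v. braid_eq n w v}"

type_synonym braid = "braid_word set"

definition braid_group :: "nat \<Rightarrow> braid monoid" where
  "braid_group n =
    \<lparr>carrier = braid_class n ` braid_words n,
     mult = (\<lambda>A B. {w. \<exists>u\<in>A. \<exists>v\<in>B. braid_eq n (u @ v) w}),
     one = braid_class n []\<rparr>"

definition sigma :: "nat \<Rightarrow> nat \<Rightarrow> braid" where
  "sigma n i = braid_class n [(True, i)]"

subsection \<open>It is a group, generated as expected\<close>

lemma braid_words_simps [simp]:
  "[] \<in> braid_words n"
  "x # w \<in> braid_words n \<longleftrightarrow> snd x \<in> {1..<n} \<and> w \<in> braid_words n"
  "u @ v \<in> braid_words n \<longleftrightarrow> u \<in> braid_words n \<and> v \<in> braid_words n"
  by (cases x; auto simp: braid_words_def)+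

lemma braid_eq_words: "braid_eq n u v \<Longrightarrow> u \<in> braid_words n \<and> v \<in> braid_words n"
  by (induction rule: braid_eq.induct) auto

lemma braid_eq_append:
  assumes "braid_eq n u u'" "braid_eq n v v'"
  shows "braid_eq n (u @ v) (u' @ v')"
proof -
  have "braid_eq n (u @ v) (u' @ v)"
    using braid_eq.append[OF assms(1), of "[]" v] braid_eq_words[OF assms(2)] by simp
  moreover have "braid_eq n (u' @ v) (u' @ v')"
    using braid_eq.append[OF assms(2), of u' "[]"] braid_eq_words[OF assms(1)] by simp
  ultimately show ?thesis by (rule braid_eq.trans)
qed

lemma braid_class_eq_iff:
  assumes "u \<in> braid_words n"
  shows "braid_class n u = braid_class n v \<longleftrightarrow> braid_eq n u v"
  unfolding braid_class_def using assms
  by (auto intro: braid_eq.refl braid_eq.sym braid_eq.trans)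

lemma braid_class_in_carrier [simp]:
  "w \<in> braid_words n \<Longrightarrow> braid_class n w \<in> carrier (braid_group n)"
  by (simp add: braid_group_def)

lemma braid_class_mult:
  assumes "u \<in> braid_words n" "v \<in> braid_words n"
  shows "braid_class n u \<otimes>\<^bsub>braid_group n\<^esub> braid_class n v = braid_class n (u @ v)"
  using assms unfolding braid_group_def braid_class_def
  by (auto intro: braid_eq.refl braid_eq.trans braid_eq_append)

definition word_inv :: "braid_word \<Rightarrow> braid_word" where
  "word_inv w = rev (map (\<lambda>(e, i). (\<not> e, i)) w)"

lemma word_inv_words [simp]: "w \<in> braid_words n \<Longrightarrow> word_inv w \<in> braid_words n"
  by (induction w) (auto simp: word_inv_def)

lemma word_inv_left: "w \<in> braid_words n \<Longrightarrow> braid_eq n (word_inv w @ w) []"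
proof (induction w)
  case Nil
  then show ?case by (auto simp: word_inv_def intro: braid_eq.refl)
next
  case (Cons x w)
  obtain e i where x: "x = (e, i)" by force
  have w: "w \<in> braid_words n" and i: "i \<in> {1..<n}" using Cons.prems x by auto
  have c: "braid_eq n [(\<not> e, i), (e, i)] []"
    using braid_eq.cancel[OF i, of "\<not> e"] by simp
  have "braid_eq n (word_inv w @ [(\<not> e, i), (e, i)] @ w) (word_inv w @ [] @ w)"
    by (rule braid_eq.append[OF c]) (use w in auto)
  then have "braid_eq n (word_inv (x # w) @ x # w) (word_inv w @ w)"
    by (simp add: x word_inv_def)
  then show ?case using Cons.IH[OF w] by (rule braid_eq.trans)
qed

lemma group_braid_group: "group (braid_group n)"
proof (rule groupI)
  have one: "\<one>\<^bsub>braid_group n\<^esub> = braid_class n []"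
    by (simp add: braid_group_def)
  have car: "\<exists>w\<in>braid_words n. x = braid_class n w" if "x \<in> carrier (braid_group n)" for x
    using that by (auto simp: braid_group_def)
  show "\<one>\<^bsub>braid_group n\<^esub> \<in> carrier (braid_group n)"
    by (simp add: one)
  fix x assume "x \<in> carrier (braid_group n)"
  then obtain u where u: "u \<in> braid_words n" "x = braid_class n u"
    using car by blast
  show "\<one>\<^bsub>braid_group n\<^esub> \<otimes>\<^bsub>braid_group n\<^esub> x = x"
    using u by (simp add: one braid_class_mult)
  show "\<exists>y\<in>carrier (braid_group n). y \<otimes>\<^bsub>braid_group n\<^esub> x = \<one>\<^bsub>braid_group n\<^esub>"
    using u
    by (intro bexI[of _ "braid_class n (word_inv u)"])
      (auto simp: one braid_class_mult braid_class_eq_iff word_inv_left)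
  fix y assume "y \<in> carrier (braid_group n)"
  then obtain v where v: "v \<in> braid_words n" "y = braid_class n v"
    using car by blast
  show "x \<otimes>\<^bsub>braid_group n\<^esub> y \<in> carrier (braid_group n)"
    using u v by (simp add: braid_class_mult)
  fix z assume "z \<in> carrier (braid_group n)"
  then obtain w where "w \<in> braid_words n" "z = braid_class n w"
    using car by blast
  then show "x \<otimes>\<^bsub>braid_group n\<^esub> y \<otimes>\<^bsub>braid_group n\<^esub> z =
      x \<otimes>\<^bsub>braid_group n\<^esub> (y \<otimes>\<^bsub>braid_group n\<^esub> z)"
    using u v by (simp add: braid_class_mult)
qed

lemma sigma_in_carrier: "i \<in> {1..<n} \<Longrightarrow> sigma n i \<in> carrier (braid_group n)"
  by (simp add: sigma_def)

lemma sigma_far: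
  assumes "i \<in> {1..<n}" "j \<in> {1..<n}" "i + 2 \<le> j"
  shows "sigma n i \<otimes>\<^bsub>braid_group n\<^esub> sigma n j = sigma n j \<otimes>\<^bsub>braid_group n\<^esub> sigma n i"
  using assms braid_eq.far[OF assms]
  by (simp add: sigma_def braid_class_mult braid_class_eq_iff)

lemma sigma_braid:
  assumes "i \<in> {1..<n}" "i + 1 \<in> {1..<n}"
  shows "sigma n i \<otimes>\<^bsub>braid_group n\<^esub> sigma n (i + 1) \<otimes>\<^bsub>braid_group n\<^esub> sigma n i =
    sigma n (i + 1) \<otimes>\<^bsub>braid_group n\<^esub> sigma n i \<otimes>\<^bsub>braid_group n\<^esub> sigma n (i + 1)"
  using assms braid_eq.braid[OF assms]
  by (simp add: sigma_def braid_class_mult braid_class_eq_iff)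

section \<open>The Garside structure\<close>

inductive_set positive_braids :: "nat \<Rightarrow> braid set" for n where
  one: "\<one>\<^bsub>braid_group n\<^esub> \<in> positive_braids n"
| gen: "i \<in> {1..<n} \<Longrightarrow> sigma n i \<in> positive_braids n"
| mult: "a \<in> positive_braids n \<Longrightarrow> b \<in> positive_braids n
    \<Longrightarrow> a \<otimes>\<^bsub>braid_group n\<^esub> b \<in> positive_braids n"

definition braid_prod :: "nat \<Rightarrow> braid list \<Rightarrow> braid" where
  "braid_prod n xs = foldr (mult (braid_group n)) xs \<one>\<^bsub>braid_group n\<^esub>"

text \<open>The index list is \<open>1, 2, 1, 3, 2, 1, \<dots>, n - 1, \<dots>, 1\<close>.\<close>

definition Delta :: "nat \<Rightarrow> braid" where
  "Delta n = braid_prod n (map (sigma n) (concat (map (\<lambda>k. rev [1..<Suc k]) [1..<n])))"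

definition Delta_pow :: "nat \<Rightarrow> int \<Rightarrow> braid" where
  "Delta_pow n p = Delta n [^]\<^bsub>braid_group n\<^esub> p"

definition left_order :: "nat \<Rightarrow> braid gorder" where
  "left_order n =
    \<lparr>carrier = carrier (braid_group n), eq = (=),
     le = (\<lambda>a b. inv\<^bsub>braid_group n\<^esub> a \<otimes>\<^bsub>braid_group n\<^esub> b \<in> positive_braids n)\<rparr>"

text \<open>In \<open>right_order\<close>, \<open>a\<close> lies below \<open>b\<close> iff \<open>a\<close> is a right divisor of \<open>b\<close>,
  i.e. iff \<open>b \<succcurlyeq> a\<close>.\<close>

definition right_order :: "nat \<Rightarrow> braid gorder" where
  "right_order n =
    \<lparr>carrier = carrier (braid_group n), eq = (=),
     le = (\<lambda>a b. b \<otimes>\<^bsub>braid_group n\<^esub> inv\<^bsub>braid_group n\<^esub> a \<in> positive_braids n)\<rparr>"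

definition left_gcd :: "nat \<Rightarrow> braid \<Rightarrow> braid \<Rightarrow> braid" where
  "left_gcd n a b = a \<sqinter>\<^bsub>left_order n\<^esub> b"

definition right_gcd :: "nat \<Rightarrow> braid \<Rightarrow> braid \<Rightarrow> braid" where
  "right_gcd n a b = a \<sqinter>\<^bsub>right_order n\<^esub> b"

text \<open>The \<open>k\<close>-th power of the automorphism \<open>\<tau>(g) = \<Delta>\<^sup>-\<^sup>1 g \<Delta>\<close>, for an arbitrary integer \<open>k\<close>.\<close>

definition tau_pow :: "nat \<Rightarrow> int \<Rightarrow> braid \<Rightarrow> braid" where
  "tau_pow n k g = Delta_pow n (- k) \<otimes>\<^bsub>braid_group n\<^esub> g \<otimes>\<^bsub>braid_group n\<^esub> Delta_pow n k"

section \<open>Normal forms\<close>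

text \<open>\<open>is_left_nf n x p xs\<close> says that \<open>\<Delta>\<^sup>p x\<^sub>1 \<cdots> x\<^sub>r\<close>, with \<open>xs = [x\<^sub>1, \<dots>, x\<^sub>r]\<close>, is, as written,
  the left normal form of \<open>x\<close>. Lists are indexed from 0.\<close>

definition is_left_nf :: "nat \<Rightarrow> braid \<Rightarrow> int \<Rightarrow> braid list \<Rightarrow> bool" where
  "is_left_nf n x p xs \<longleftrightarrow>
    set xs \<subseteq> carrier (braid_group n) \<and>
    x = Delta_pow n p \<otimes>\<^bsub>braid_group n\<^esub> braid_prod n xs \<and>
    Delta_pow n (- p) \<otimes>\<^bsub>braid_group n\<^esub> x \<in> positive_braids n \<and>
    (\<forall>q. Delta_pow n (- q) \<otimes>\<^bsub>braid_group n\<^esub> x \<in> positive_braids n \<longrightarrow> q \<le> p) \<and>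
    (\<forall>i<length xs. xs ! i = left_gcd n (braid_prod n (drop i xs)) (Delta n) \<and>
       xs ! i \<noteq> \<one>\<^bsub>braid_group n\<^esub>)"

definition is_right_nf :: "nat \<Rightarrow> braid \<Rightarrow> braid list \<Rightarrow> int \<Rightarrow> bool" where
  "is_right_nf n x ys p \<longleftrightarrow>
    set ys \<subseteq> carrier (braid_group n) \<and>
    x = braid_prod n ys \<otimes>\<^bsub>braid_group n\<^esub> Delta_pow n p \<and>
    x \<otimes>\<^bsub>braid_group n\<^esub> Delta_pow n (- p) \<in> positive_braids n \<and>
    (\<forall>q. x \<otimes>\<^bsub>braid_group n\<^esub> Delta_pow n (- q) \<in> positive_braids n \<longrightarrow> q \<le> p) \<and>
    (\<forall>i<length ys. ys ! i = right_gcd n (braid_prod n (take (Suc i) ys)) (Delta n) \<and>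
       ys ! i \<noteq> \<one>\<^bsub>braid_group n\<^esub>)"

text \<open>The left and the right normal form have the same number of factors; the left one is
  used here.\<close>

definition canonical_length :: "nat \<Rightarrow> braid \<Rightarrow> nat" where
  "canonical_length n x = (THE r. \<exists>p xs. is_left_nf n x p xs \<and> length xs = r)"

section \<open>Rigidity\<close>

text \<open>Below, \<open>tau_pow n (- p) (hd xs)\<close> is \<open>\<iota>\<^sub>L(x)\<close> and \<open>tau_pow n p (last ys)\<close> is \<open>\<iota>\<^sub>R(x)\<close>.\<close>

definition left_rigid :: "nat \<Rightarrow> braid \<Rightarrow> bool" where
  "left_rigid n x \<longleftrightarrow>
    (\<exists>p xs. is_left_nf n x p xs \<and> xs \<noteq> [] \<and>
      is_left_nf n (x \<otimes>\<^bsub>braid_group n\<^esub> tau_pow n (- p) (hd xs))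
        p (xs @ [tau_pow n (- p) (hd xs)]))"

definition right_rigid :: "nat \<Rightarrow> braid \<Rightarrow> bool" where
  "right_rigid n x \<longleftrightarrow>
    (\<exists>ys p. is_right_nf n x ys p \<and> ys \<noteq> [] \<and>
      is_right_nf n (tau_pow n p (last ys) \<otimes>\<^bsub>braid_group n\<^esub> x)
        (tau_pow n p (last ys) # ys) p)"

definition conjugate :: "nat \<Rightarrow> braid \<Rightarrow> braid \<Rightarrow> bool" where
  "conjugate n x y \<longleftrightarrow>
    (\<exists>c\<in>carrier (braid_group n).
      y = inv\<^bsub>braid_group n\<^esub> c \<otimes>\<^bsub>braid_group n\<^esub> x \<otimes>\<^bsub>braid_group n\<^esub> c)"

end

theory Submission
  imports Defs
begin

text \<open>
Left divisibility is an order on the braid group that is invariant under left translations and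
under right multiplication by \<open>\<Delta>\<close>, and it is a lattice. The first \<open>i\<close> factors of the left normal form of
a positive braid \<open>X\<close> multiply to the greatest common divisor of \<open>X\<close> and \<open>\<Delta>\<^sup>i\<close>. It follows
(\<open>rigid_iff_data\<close>) that a braid \<open>x\<close> is left rigid if and only if, for some integers \<open>p\<close> and \<open>q\<close>, the braids
\<open>x \<Delta>\<^sup>-\<^sup>p\<close> and \<open>x\<^sup>-\<^sup>1 \<Delta>\<^sup>q\<close> are positive, nontrivial and coprime. The same statement
in the opposite group characterizes right rigidity.

For a braid \<open>v\<close>, let \<open>A v = x\<^sup>-\<^sup>1 v \<Delta>\<^sup>p\<close> and \<open>B v = x v \<Delta>\<^sup>-\<^sup>q\<close>; both maps are automorphisms of
the lattice. Suppose that the braid obtained by conjugating \<open>x\<close> by \<open>v\<close> has infimum at least \<open>p\<close> and supremum at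
most \<open>q\<close>, and is not a power of \<open>\<Delta>\<close>. It is then left rigid (with these \<open>p\<close> and \<open>q\<close>) when \<open>v\<close> is the
meet of \<open>A\<^sup>-\<^sup>1 v\<close> and \<open>B\<^sup>-\<^sup>1 v\<close>, and right rigid when \<open>v\<close> is the join of \<open>A v\<close> and \<open>B v\<close>. The map
sending \<open>v\<close> to this join is lower adjoint to the map sending \<open>v\<close> to this meet. A fixed point of the upper
adjoint therefore confines the orbits of the lower adjoint; together with the finiteness of the
set of conjugates of \<open>x\<close> between \<open>\<Delta>\<^sup>p\<close> and \<open>\<Delta>\<^sup>q\<close>, this forces the decreasing orbit of
the identity under the lower adjoint to become constant (\<open>exists_join_fixed_point\<close>). So a left rigid braid is conjugate
to a right rigid one (\<open>rigid_conjugate_opposite_rigid\<close>), and the converse is the same statement in the opposite group.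

That the braid group is a lattice is Garside's theorem. It rests on two facts: in the monoid
of positive words, a common multiple of two generators is a multiple of their least common multiple
(\<open>garside_key\<close>), and this monoid embeds in the braid group, because every signed word has a
well-defined expression as a fraction with a power of \<open>\<Delta>\<close> as denominator
(\<open>fraction_cong\<close>).
\<close>

section \<open>Divisibility in ordered groups and Garside groups\<close>

text \<open>Right divisibility in a group is left divisibility in its opposite. Working in the opposite
group turns right normal forms and right rigidity into their left counterparts, so that the
abstract theory is developed for one side only.\<close>

definition opposite :: "('a, 'b) monoid_scheme \<Rightarrow> 'a monoid" where
  "opposite G = \<lparr>carrier = carrier G, mult = (\<lambda>x y. y \<otimes>\<^bsub>G\<^esub> x), one = \<one>\<^bsub>G\<^esub>\<rparr>"

lemma opposite_simps [simp]:
  "carrier (opposite G) = carrier G" "x \<otimes>\<^bsub>opposite G\<^esub> y = y \<otimes>\<^bsub>G\<^esub> x" "\<one>\<^bsub>opposite G\<^esub> = \<one>\<^bsub>G\<^esub>"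
  by (simp_all add: opposite_def)

lemma (in group) opposite_group: "group (opposite G)"
proof (rule groupI)
  show "\<exists>y\<in>carrier (opposite G). y \<otimes>\<^bsub>opposite G\<^esub> x = \<one>\<^bsub>opposite G\<^esub>"
    if "x \<in> carrier (opposite G)" for x
    using that by (intro bexI[of _ "inv x"]) simp_all
qed (simp_all add: m_assoc)

lemma (in group) opposite_inv [simp]:
  assumes "x \<in> carrier G"
  shows "inv\<^bsub>opposite G\<^esub> x = inv x"
  by (rule group.inv_equality[OF opposite_group]) (use assms in simp_all)

lemma (in group) opposite_nat_pow:
  assumes "x \<in> carrier G"
  shows "x [^]\<^bsub>opposite G\<^esub> (k::nat) = x [^] k"
proof (induction k)
  case (Suc k)
  have "x [^]\<^bsub>opposite G\<^esub> Suc k = x \<otimes> x [^] k"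
    using Suc by (simp add: nat_pow_def)
  then show ?case using nat_pow_Suc2[OF assms] by simp
qed (simp add: nat_pow_def)

lemma (in group) opposite_int_pow [simp]:
  assumes "x \<in> carrier G"
  shows "x [^]\<^bsub>opposite G\<^esub> (k::int) = x [^] k"
  unfolding int_pow_def2 using assms
  by (simp only: opposite_nat_pow opposite_inv nat_pow_closed)

text \<open>A group with a submonoid of positive elements, and a homomorphism to the integers that is
positive on all positive elements other than the identity. For braids this is the exponent sum.
It makes the divisibility order antisymmetric and replaces all finiteness and
termination arguments about chains of divisors.\<close>

locale positive_cone = group G for G (structure) +
  fixes P :: "'a set" and len :: "'a \<Rightarrow> int"
  assumes pos_closed: "P \<subseteq> carrier G"
    and pos_one: "\<one> \<in> P"
    and pos_mult: "a \<in> P \<Longrightarrow> b \<in> P \<Longrightarrow> a \<otimes> b \<in> P"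
    and len_mult: "x \<in> carrier G \<Longrightarrow> y \<in> carrier G \<Longrightarrow> len (x \<otimes> y) = len x + len y"
    and len_nonneg: "a \<in> P \<Longrightarrow> 0 \<le> len a"
    and len_eq_0: "a \<in> P \<Longrightarrow> len a = 0 \<Longrightarrow> a = \<one>"
begin

abbreviation le :: "'a \<Rightarrow> 'a \<Rightarrow> bool" (infix "\<preceq>" 50) where
  "a \<preceq> b \<equiv> inv a \<otimes> b \<in> P"

lemma pos_carrier [simp]: "a \<in> P \<Longrightarrow> a \<in> carrier G"
  using pos_closed by auto

lemma len_one [simp]: "len \<one> = 0"
  using len_mult[of \<one> \<one>] by simp

lemma len_inv [simp]: "x \<in> carrier G \<Longrightarrow> len (inv x) = - len x"
  using len_mult[of "inv x" x] by simp

lemma inv_cancel [simp]: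
  assumes "x \<in> carrier G" "y \<in> carrier G"
  shows "inv x \<otimes> (x \<otimes> y) = y" "x \<otimes> (inv x \<otimes> y) = y"
  using assms by (simp_all flip: m_assoc)

lemma inv_cancel_right [simp]:
  assumes "x \<in> carrier G" "y \<in> carrier G"
  shows "y \<otimes> inv x \<otimes> x = y" "y \<otimes> x \<otimes> inv x = y"
  using assms by (simp_all add: m_assoc)

lemma commute_inv:
  assumes "x \<otimes> y = y \<otimes> x" "x \<in> carrier G" "y \<in> carrier G"
  shows "inv x \<otimes> y = y \<otimes> inv x"
proof -
  have "inv x \<otimes> y = inv x \<otimes> (y \<otimes> x) \<otimes> inv x" using assms(2,3) by (simp add: m_assoc)
  also have "\<dots> = inv x \<otimes> (x \<otimes> y) \<otimes> inv x" by (simp only: assms(1))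
  also have "\<dots> = y \<otimes> inv x" using assms(2,3) by simp
  finally show ?thesis .
qed

lemma le_refl [simp]: "a \<in> carrier G \<Longrightarrow> a \<preceq> a"
  by (simp add: pos_one)

lemma le_trans:
  assumes "a \<preceq> b" "b \<preceq> c" "a \<in> carrier G" "b \<in> carrier G" "c \<in> carrier G"
  shows "a \<preceq> c"
  using pos_mult[OF assms(1,2)] assms(3-) by (simp add: m_assoc)

lemma le_antisym:
  assumes "a \<preceq> b" "b \<preceq> a" "a \<in> carrier G" "b \<in> carrier G"
  shows "a = b"
proof -
  have "len (inv a \<otimes> b) = 0"
    using len_nonneg[OF assms(1)] len_nonneg[OF assms(2)] assms(3,4) by (simp add: len_mult)
  then have "inv a \<otimes> b = \<one>" using assms(1) len_eq_0 by blast
  then show ?thesis using assms(3,4) by (metis inv_cancel(2) r_one)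
qed

lemma le_translate [simp]:
  assumes "a \<in> carrier G" "b \<in> carrier G" "c \<in> carrier G"
  shows "c \<otimes> a \<preceq> c \<otimes> b \<longleftrightarrow> a \<preceq> b"
  using assms by (simp add: inv_mult_group m_assoc)

lemma one_le [simp]: "a \<in> carrier G \<Longrightarrow> \<one> \<preceq> a \<longleftrightarrow> a \<in> P"
  by simp

definition is_glb :: "'a \<Rightarrow> 'a \<Rightarrow> 'a \<Rightarrow> bool" where
  "is_glb d a b \<longleftrightarrow> d \<in> carrier G \<and> d \<preceq> a \<and> d \<preceq> b \<and>
     (\<forall>e\<in>carrier G. e \<preceq> a \<longrightarrow> e \<preceq> b \<longrightarrow> e \<preceq> d)"

lemma is_glb_unique:
  "is_glb d a b \<Longrightarrow> is_glb e a b \<Longrightarrow> d = e"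
  unfolding is_glb_def by (blast intro: le_antisym)

lemma is_glb_translate:
  assumes "c \<in> carrier G" "d \<in> carrier G" "a \<in> carrier G" "b \<in> carrier G"
  shows "is_glb (c \<otimes> d) (c \<otimes> a) (c \<otimes> b) \<longleftrightarrow> is_glb d a b"
proof -
  have 1: "e \<preceq> c \<otimes> z \<longleftrightarrow> inv c \<otimes> e \<preceq> z" if "e \<in> carrier G" "z \<in> carrier G" for e z
    using that assms le_translate[of "inv c \<otimes> e" z c] by simp
  have 2: "e \<preceq> z \<longleftrightarrow> c \<otimes> e \<preceq> c \<otimes> z" if "e \<in> carrier G" "z \<in> carrier G" for e z
    using that assms by simp
  show ?thesis
    unfolding is_glb_def using assms
    by (safe; (simp; fail)?) (metis 1 2 m_closed inv_closed)+
qed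

definition is_lub :: "'a \<Rightarrow> 'a \<Rightarrow> 'a \<Rightarrow> bool" where
  "is_lub d a b \<longleftrightarrow> d \<in> carrier G \<and> a \<preceq> d \<and> b \<preceq> d \<and>
     (\<forall>e\<in>carrier G. a \<preceq> e \<longrightarrow> b \<preceq> e \<longrightarrow> d \<preceq> e)"

lemma is_lub_unique:
  "is_lub d a b \<Longrightarrow> is_lub e a b \<Longrightarrow> d = e"
  unfolding is_lub_def by (blast intro: le_antisym)

lemma is_lub_translate:
  assumes "c \<in> carrier G" "d \<in> carrier G" "a \<in> carrier G" "b \<in> carrier G"
  shows "is_lub (c \<otimes> d) (c \<otimes> a) (c \<otimes> b) \<longleftrightarrow> is_lub d a b"
proof -
  have 1: "c \<otimes> z \<preceq> e \<longleftrightarrow> z \<preceq> inv c \<otimes> e" if "e \<in> carrier G" "z \<in> carrier G" for e z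
    using that assms le_translate[of z "inv c \<otimes> e" c] by simp
  have 2: "z \<preceq> e \<longleftrightarrow> c \<otimes> z \<preceq> c \<otimes> e" if "e \<in> carrier G" "z \<in> carrier G" for e z
    using that assms by simp
  show ?thesis
    unfolding is_lub_def using assms
    by (safe; (simp; fail)?) (metis 1 2 m_closed inv_closed)+
qed

text \<open>Among the common lower bounds, whose lengths are bounded by the length of \<open>a\<close>, take a
longest one \<open>d\<close>. Its least upper bound with any other common lower bound is again a
common lower bound and is no longer than \<open>d\<close>, hence equals \<open>d\<close>.\<close>

lemma glb_ex_if_lub_ex:
  assumes lub: "\<And>a b. a \<in> carrier G \<Longrightarrow> b \<in> carrier G \<Longrightarrow> \<exists>d. is_lub d a b"
    and a: "a \<in> carrier G" and b: "b \<in> carrier G"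
    and c: "c \<in> carrier G" "c \<preceq> a" "c \<preceq> b"
  shows "\<exists>d. is_glb d a b"
proof -
  let ?L = "{d \<in> carrier G. d \<preceq> a \<and> d \<preceq> b}"
  have bound: "len d \<le> len a" if "d \<in> ?L" for d
    using that len_nonneg[of "inv d \<otimes> a"] a by (simp add: len_mult)
  obtain d where d: "d \<in> ?L" and max: "\<And>e. e \<in> ?L \<Longrightarrow> len e \<le> len d"
  proof -
    obtain d where "d \<in> ?L" "\<And>e. e \<in> ?L \<Longrightarrow> nat (len a - len d) \<le> nat (len a - len e)"
      using arg_min_nat_lemma[of "\<lambda>d. d \<in> ?L" c "\<lambda>d. nat (len a - len d)"] c by auto
    then show thesis using that[of d] bound by force
  qed
  have "e \<preceq> d" if e: "e \<in> carrier G" "e \<preceq> a" "e \<preceq> b" for e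
  proof -
    have dc: "d \<in> carrier G" "d \<preceq> a" "d \<preceq> b" using d by simp_all
    obtain f where f: "is_lub f d e" using lub[OF dc(1) e(1)] by blast
    then have fc: "f \<in> carrier G" "d \<preceq> f" "e \<preceq> f" "f \<preceq> a" "f \<preceq> b"
      using a b dc e by (simp_all add: is_lub_def)
    then have "len f \<le> len d" using max by simp
    then have "len (inv d \<otimes> f) = 0" using len_nonneg[OF fc(2)] fc(1) dc(1) by (simp add: len_mult)
    then have "d = f" using len_eq_0[OF fc(2)] fc(1) dc(1) by (metis inv_cancel(2) r_one)
    then show ?thesis using fc by simp
  qed
  then show ?thesis using d by (auto simp: is_glb_def)
qed

end

text \<open>The part of the theory of Garside groups that the rigidity argument uses. The axioms are invariant
under passage to the opposite group; this is why \<open>atom\<close> comes in a left and a right version and why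
both bounds are required.\<close>

locale garside_group = positive_cone G P len for G (structure) and P len +
  fixes \<delta> :: 'a
  assumes delta_pos: "\<delta> \<in> P"
    and pos_conj: "a \<in> P \<Longrightarrow> inv \<delta> \<otimes> a \<otimes> \<delta> \<in> P" "a \<in> P \<Longrightarrow> \<delta> \<otimes> a \<otimes> inv \<delta> \<in> P"
    and finite_len: "finite {a \<in> P. len a = m}"
    and atom: "a \<in> P \<Longrightarrow> a \<noteq> \<one> \<Longrightarrow> \<exists>s\<in>P. s \<noteq> \<one> \<and> inv s \<otimes> a \<in> P \<and> inv s \<otimes> \<delta> \<in> P"
    and atom': "a \<in> P \<Longrightarrow> a \<noteq> \<one> \<Longrightarrow> \<exists>s\<in>P. s \<noteq> \<one> \<and> a \<otimes> inv s \<in> P \<and> \<delta> \<otimes> inv s \<in> P"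
    and glb_ex: "a \<in> carrier G \<Longrightarrow> b \<in> carrier G \<Longrightarrow> \<exists>d. is_glb d a b"
    and lub_ex: "a \<in> carrier G \<Longrightarrow> b \<in> carrier G \<Longrightarrow> \<exists>d. is_lub d a b"
begin

lemma delta_carrier [simp]: "\<delta> \<in> carrier G"
  by (simp add: delta_pos)

lemma pos_conj_pow:
  assumes "a \<in> P"
  shows "\<delta> [^] (- k::int) \<otimes> a \<otimes> \<delta> [^] k \<in> P"
proof (induction k rule: int_induct[where k = 0])
  case base
  then show ?case using assms by simp
next
  case (step1 i)
  have "inv \<delta> \<otimes> (\<delta> [^] (- i) \<otimes> a \<otimes> \<delta> [^] i) \<otimes> \<delta> \<in> P" using pos_conj(1) step1 by blast
  moreover have "\<delta> [^] (- (i + 1)) = inv \<delta> \<otimes> \<delta> [^] (- i)" "\<delta> [^] (i + 1) = \<delta> [^] i \<otimes> \<delta>"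
    using int_pow_mult[of \<delta> "- 1" "- i"] int_pow_mult[of \<delta> i 1]
    by (simp_all add: int_pow_neg algebra_simps int_pow_1)
  ultimately show ?case using assms by (simp add: m_assoc)
next
  case (step2 i)
  have "\<delta> \<otimes> (\<delta> [^] (- i) \<otimes> a \<otimes> \<delta> [^] i) \<otimes> inv \<delta> \<in> P" using pos_conj(2) step2 by blast
  moreover have "\<delta> [^] (- (i - 1)) = \<delta> \<otimes> \<delta> [^] (- i)" "\<delta> [^] (i - 1) = \<delta> [^] i \<otimes> inv \<delta>"
    using int_pow_mult[of \<delta> "1" "- i"] int_pow_mult[of \<delta> i "- 1"]
    by (simp_all add: int_pow_neg algebra_simps int_pow_1)
  ultimately show ?case using assms by (simp add: m_assoc)
qed

lemma delta_pow_add: "\<delta> [^] (i::int) \<otimes> \<delta> [^] (j::int) = \<delta> [^] (i + j)"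
  by (simp add: int_pow_mult)

lemma inv_delta_pow: "inv (\<delta> [^] (i::int)) = \<delta> [^] (- i)"
  by (simp add: int_pow_neg)

lemma delta_pow_1 [simp]: "\<delta> [^] (1::int) = \<delta>"
  by (simp add: int_pow_1)

lemma delta_pow_Suc: "\<delta> [^] (i + 1 :: int) = \<delta> [^] i \<otimes> \<delta>"
  using delta_pow_add[of i 1] by simp

text \<open>The order is invariant under left translations by definition. Since conjugation by \<open>\<delta>\<close>
preserves the positive elements, right multiplication by a power of \<open>\<delta>\<close> is an
order automorphism too.\<close>

lemma le_mult_delta_pow [simp]:
  assumes "a \<in> carrier G" "b \<in> carrier G"
  shows "a \<otimes> \<delta> [^] (k::int) \<preceq> b \<otimes> \<delta> [^] k \<longleftrightarrow> a \<preceq> b"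
proof
  assume "a \<preceq> b"
  from pos_conj_pow[OF this, of k] show "a \<otimes> \<delta> [^] k \<preceq> b \<otimes> \<delta> [^] k"
    using assms by (simp add: inv_mult_group m_assoc inv_delta_pow)
next
  assume "a \<otimes> \<delta> [^] k \<preceq> b \<otimes> \<delta> [^] k"
  from pos_conj_pow[OF this, of "- k"]
  have "\<delta> [^] k \<otimes> (\<delta> [^] (- k) \<otimes> (inv a \<otimes> b) \<otimes> \<delta> [^] k) \<otimes> \<delta> [^] (- k) \<in> P"
    using assms by (simp add: inv_mult_group m_assoc inv_delta_pow)
  then show "a \<preceq> b"
    using assms by (simp add: m_assoc flip: inv_delta_pow)
qed

lemma delta_pow_pos: "0 \<le> k \<Longrightarrow> \<delta> [^] (k::int) \<in> P"
proof (induction k rule: int_ge_induct)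
  case base
  then show ?case by (simp add: pos_one)
next
  case (step i)
  then show ?case unfolding delta_pow_Suc by (intro pos_mult delta_pos)
qed

lemma delta_pow_le: "i \<le> j \<Longrightarrow> \<delta> [^] (i::int) \<preceq> \<delta> [^] (j::int)"
  using delta_pow_pos[of "j - i"] by (simp add: inv_delta_pow delta_pow_add)

lemma is_glb_mult_delta_pow:
  assumes "is_glb d a b" "a \<in> carrier G" "b \<in> carrier G"
  shows "is_glb (d \<otimes> \<delta> [^] (k::int)) (a \<otimes> \<delta> [^] k) (b \<otimes> \<delta> [^] k)"
proof -
  have 1: "e \<preceq> z \<otimes> \<delta> [^] k \<longleftrightarrow> e \<otimes> \<delta> [^] (- k) \<preceq> z" if "e \<in> carrier G" "z \<in> carrier G" for e z
    using that le_mult_delta_pow[of "e \<otimes> \<delta> [^] (- k)" z k]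
    by (simp add: m_assoc delta_pow_add)
  show ?thesis
    using assms unfolding is_glb_def by (simp add: 1 m_assoc delta_pow_add)
qed

text \<open>This turns the recursive description of a normal form, in which each prefix is the greatest lower
bound of \<open>X\<close> and the previous prefix times \<open>\<delta>\<close>, into the closed one: the prefix with
\<open>i\<close> factors is the greatest lower bound of \<open>X\<close> and the \<open>i\<close>-th power of \<open>\<delta>\<close>.
An element below \<open>X\<close> is automatically below \<open>X \<otimes> \<delta>\<close>, so comparing it with
\<open>g \<otimes> \<delta>\<close>, which is the greatest lower bound of \<open>X \<otimes> \<delta>\<close> and the next power of
\<open>\<delta>\<close>, only tests the latter.\<close>

lemma is_glb_step:
  assumes g: "is_glb g X (\<delta> [^] (i::int))" and X: "X \<in> carrier G"
  shows "is_glb h X (g \<otimes> \<delta>) \<longleftrightarrow> is_glb h X (\<delta> [^] (i + 1))"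
proof -
  have gc: "g \<in> carrier G" using g by (simp add: is_glb_def)
  have gd: "is_glb (g \<otimes> \<delta>) (X \<otimes> \<delta>) (\<delta> [^] (i + 1))"
    using is_glb_mult_delta_pow[OF g X, of 1] by (simp add: delta_pow_Suc)
  have "e \<preceq> g \<otimes> \<delta> \<longleftrightarrow> e \<preceq> \<delta> [^] (i + 1)" if e: "e \<in> carrier G" "e \<preceq> X" for e
  proof
    assume "e \<preceq> g \<otimes> \<delta>"
    moreover have "g \<otimes> \<delta> \<preceq> \<delta> [^] (i + 1)" using gd by (simp add: is_glb_def)
    ultimately show "e \<preceq> \<delta> [^] (i + 1)" using e gc by (blast intro: le_trans int_pow_closed delta_carrier m_closed)
  next
    assume "e \<preceq> \<delta> [^] (i + 1)"
    moreover have "e \<preceq> X \<otimes> \<delta>"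
      using le_trans[OF e(2), of "X \<otimes> \<delta>"] e X by (simp add: delta_pos)
    ultimately show "e \<preceq> g \<otimes> \<delta>" using gd e by (simp add: is_glb_def)
  qed
  then show ?thesis unfolding is_glb_def by blast
qed

text \<open>Every nontrivial positive element is divisible by a nontrivial divisor of \<open>\<delta>\<close>, so coprimality
has to be tested on divisors of \<open>\<delta>\<close> only.\<close>

lemma is_glb_oneI:
  assumes "a \<in> P" "b \<in> P" and s: "\<And>s. s \<in> P \<Longrightarrow> s \<preceq> a \<Longrightarrow> s \<preceq> b \<Longrightarrow> s \<preceq> \<delta> \<Longrightarrow> s = \<one>"
  shows "is_glb \<one> a b"
proof -
  obtain d where d: "is_glb d a b" using glb_ex assms by (meson pos_carrier)
  then have dc: "d \<in> carrier G" and le: "d \<preceq> a" "d \<preceq> b" by (auto simp: is_glb_def)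
  have "\<one> \<preceq> d" using d assms unfolding is_glb_def by (meson one_closed one_le pos_carrier)
  then have dP: "d \<in> P" using dc by simp
  have "d = \<one>"
  proof (rule ccontr)
    assume "d \<noteq> \<one>"
    then obtain t where t: "t \<in> P" "t \<noteq> \<one>" "t \<preceq> d" "t \<preceq> \<delta>" using atom[OF dP] by auto
    have "t \<preceq> a" "t \<preceq> b" using t le assms dc by (meson le_trans pos_carrier)+
    then show False using s t by blast
  qed
  then show ?thesis using d by simp
qed

definition lprod :: "'a list \<Rightarrow> 'a" where
  "lprod xs = foldr (\<otimes>) xs \<one>"

lemma lprod_simps [simp]: "lprod [] = \<one>" "lprod (x # xs) = x \<otimes> lprod xs"
  by (simp_all add: lprod_def)

lemma lprod_closed [simp]: "set xs \<subseteq> carrier G \<Longrightarrow> lprod xs \<in> carrier G"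
  by (induction xs) auto

lemma lprod_append: "set xs \<subseteq> carrier G \<Longrightarrow> set ys \<subseteq> carrier G \<Longrightarrow>
    lprod (xs @ ys) = lprod xs \<otimes> lprod ys"
  by (induction xs) (auto simp: m_assoc)

lemma lprod_telescope:
  assumes "\<And>i. i \<le> r \<Longrightarrow> g i \<in> carrier G" "i \<le> r" "g 0 = \<one>"
  shows "lprod (take i (map (\<lambda>i. inv (g i) \<otimes> g (Suc i)) [0..<r])) = g i"
  using assms(2)
proof (induction i)
  case 0
  then show ?case using assms(3) by simp
next
  case (Suc i)
  have "set (take i (map (\<lambda>i. inv (g i) \<otimes> g (Suc i)) [0..<r])) \<subseteq> carrier G"
    using Suc.prems by (auto dest!: in_set_takeD intro!: m_closed inv_closed assms(1))
  then show ?case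
    using Suc assms(1) by (simp add: take_Suc_conv_app_nth lprod_append)
qed

section \<open>Normal forms and rigidity in a Garside group\<close>

text \<open>The abstract left normal form; in the opposite group it is the right normal form, read backwards.\<close>

definition nf :: "'a \<Rightarrow> int \<Rightarrow> 'a list \<Rightarrow> bool" where
  "nf x p xs \<longleftrightarrow> set xs \<subseteq> carrier G \<and> x = \<delta> [^] p \<otimes> lprod xs \<and> \<delta> [^] (- p) \<otimes> x \<in> P \<and>
    (\<forall>q. \<delta> [^] (- q) \<otimes> x \<in> P \<longrightarrow> q \<le> p) \<and>
    (\<forall>i<length xs. is_glb (xs ! i) (lprod (drop i xs)) \<delta> \<and> xs ! i \<noteq> \<one>)"

lemma inf_maximal_iff:
  fixes p :: int
  assumes "\<delta> [^] (- p) \<otimes> x \<in> P" "x \<in> carrier G"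
  shows "(\<forall>q. \<delta> [^] (- q) \<otimes> x \<in> P \<longrightarrow> q \<le> p) \<longleftrightarrow> \<not> \<delta> \<preceq> \<delta> [^] (- p) \<otimes> x"
proof -
  have *: "\<delta> [^] i \<preceq> \<delta> [^] (- p) \<otimes> x \<longleftrightarrow> \<delta> [^] (- (p + i)) \<otimes> x \<in> P" for i :: int
  proof -
    have "\<delta> [^] (- i) \<otimes> \<delta> [^] (- p) = \<delta> [^] (- (p + i))"
      by (simp only: delta_pow_add minus_add_distrib add.commute)
    then show ?thesis using assms(2) by (simp add: inv_delta_pow flip: m_assoc)
  qed
  show ?thesis
  proof
    assume "\<forall>q. \<delta> [^] (- q) \<otimes> x \<in> P \<longrightarrow> q \<le> p"
    then show "\<not> \<delta> \<preceq> \<delta> [^] (- p) \<otimes> x" using *[of 1] by fastforce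
  next
    assume n: "\<not> \<delta> \<preceq> \<delta> [^] (- p) \<otimes> x"
    show "\<forall>q. \<delta> [^] (- q) \<otimes> x \<in> P \<longrightarrow> q \<le> p"
    proof (intro allI impI, rule ccontr)
      fix q assume "\<delta> [^] (- q) \<otimes> x \<in> P" and q: "\<not> q \<le> p"
      then have "\<delta> [^] (q - p) \<preceq> \<delta> [^] (- p) \<otimes> x" using *[of "q - p"] by simp
      moreover have "\<delta> \<preceq> \<delta> [^] (q - p)" using delta_pow_le[of 1 "q - p"] q by simp
      ultimately have "\<delta> \<preceq> \<delta> [^] (- p) \<otimes> x"
        using assms(2) le_trans[of \<delta> "\<delta> [^] (q - p)" "\<delta> [^] (- p) \<otimes> x"] by simp
      with n show False by simp
    qed
  qed
qed

lemma nf_glb_prefix: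
  assumes "nf x p xs" "i \<le> length xs"
  shows "is_glb (lprod (take i xs)) (lprod xs) (\<delta> [^] int i)"
  using assms(2)
proof (induction i)
  case 0
  have "x = \<delta> [^] p \<otimes> lprod xs" "set xs \<subseteq> carrier G" "\<delta> [^] (- p) \<otimes> x \<in> P"
    using assms(1) by (auto simp: nf_def)
  then have "lprod xs \<in> P" by (simp add: delta_pow_add flip: m_assoc)
  then show ?case by (simp add: is_glb_def pos_one)
next
  case (Suc i)
  have xs: "set xs \<subseteq> carrier G" using assms(1) by (simp add: nf_def)
  have sub: "set (take i xs) \<subseteq> carrier G" "set (drop i xs) \<subseteq> carrier G" "xs ! i \<in> carrier G"
    using xs Suc.prems by (auto dest: in_set_takeD in_set_dropD)
  have "is_glb (xs ! i) (lprod (drop i xs)) \<delta>" using assms(1) Suc.prems by (simp add: nf_def)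
  then have "is_glb (lprod (take i xs) \<otimes> xs ! i) (lprod (take i xs) \<otimes> lprod (drop i xs))
      (lprod (take i xs) \<otimes> \<delta>)"
    using sub by (simp add: is_glb_translate)
  moreover have "lprod (take i xs) \<otimes> lprod (drop i xs) = lprod xs"
    using lprod_append[OF sub(1,2)] by simp
  moreover have "lprod (take i xs) \<otimes> xs ! i = lprod (take (Suc i) xs)"
    using sub Suc.prems by (simp add: take_Suc_conv_app_nth lprod_append)
  ultimately show ?case
    using is_glb_step Suc.IH Suc.prems xs by (simp add: add.commute)
qed

text \<open>Conversely, the successive quotients of the greatest lower bounds \<open>g i\<close> form a normal form. No factor is
trivial: by \<open>is_glb_step\<close> the value \<open>g (Suc i)\<close> is determined by \<open>g i\<close>, so once two
consecutive values agree, all later ones do, and then \<open>X = g r\<close> would divide the \<open>r\<close>-th power of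
\<open>\<delta>\<close>.\<close>

lemma nfI:
  assumes X: "X \<in> P" "\<not> \<delta> \<preceq> X" and r: "X \<preceq> \<delta> [^] int (Suc r)" "\<not> X \<preceq> \<delta> [^] int r"
    and g: "\<And>i. i \<le> Suc r \<Longrightarrow> is_glb (g i) X (\<delta> [^] int i)"
  shows "nf (\<delta> [^] p \<otimes> X) p (map (\<lambda>i. inv (g i) \<otimes> g (Suc i)) [0..<Suc r])"
    (is "nf _ _ ?xs")
proof -
  have gc: "g i \<in> carrier G" if "i \<le> Suc r" for i using g[OF that] by (simp add: is_glb_def)
  have g0: "g 0 = \<one>"
  proof -
    have "is_glb \<one> X (\<delta> [^] int 0)" using X by (auto simp: is_glb_def pos_one)
    then show ?thesis using g[of 0] is_glb_unique by blast
  qed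
  have gr: "g (Suc r) = X"
  proof -
    have "is_glb X X (\<delta> [^] int (Suc r))" using X r pos_one by (simp add: is_glb_def)
    then show ?thesis using g[of "Suc r"] is_glb_unique by blast
  qed
  have step: "is_glb (g (Suc i)) X (g i \<otimes> \<delta>)" if "i \<le> r" for i
    using is_glb_step[OF g[of i], of "g (Suc i)"] g[of "Suc i"] that X by (simp add: add.commute)
  have len: "length ?xs = Suc r" by simp
  have xs: "set ?xs \<subseteq> carrier G" using gc by auto
  have pre: "lprod (take i ?xs) = g i" if "i \<le> Suc r" for i
    using lprod_telescope[of "Suc r" g, OF gc that g0] by simp
  have all: "lprod ?xs = X" using pre[of "Suc r"] gr by simp
  have glb: "is_glb (?xs ! i) (lprod (drop i ?xs)) \<delta>" if i: "i \<le> r" for i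
  proof -
    have "lprod (take i ?xs @ drop i ?xs) = lprod (take i ?xs) \<otimes> lprod (drop i ?xs)"
      using xs by (intro lprod_append) (blast dest: in_set_takeD in_set_dropD)+
    then have eq: "X = g i \<otimes> lprod (drop i ?xs)" 
      unfolding append_take_drop_id all pre[OF le_SucI[OF i]] .
    have nth: "?xs ! i = inv (g i) \<otimes> g (Suc i)" using i by (simp del: upt_Suc)
    have dc: "lprod (drop i ?xs) \<in> carrier G"
      using xs by (intro lprod_closed) (blast dest: in_set_dropD)
    have "is_glb (g i \<otimes> (inv (g i) \<otimes> g (Suc i))) (g i \<otimes> lprod (drop i ?xs)) (g i \<otimes> \<delta>)"
      using step[OF i] eq gc i by simp
    then have "is_glb (inv (g i) \<otimes> g (Suc i)) (lprod (drop i ?xs)) \<delta>"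
      using gc[of i] gc[of "Suc i"] i dc by (subst (asm) is_glb_translate) auto
    then show ?thesis using nth by simp
  qed
  have ne: "g i \<noteq> g (Suc i)" if i: "i \<le> r" for i
  proof
    assume eq: "g i = g (Suc i)"
    have "g (i + j) = g (Suc (i + j))" if "i + j \<le> r" for j
      using that
    proof (induction j)
      case (Suc j)
      then have "g (Suc (i + j)) = g (i + j)" by simp
      then show ?case
        using is_glb_unique[OF step[of "i + j"]] step[of "Suc (i + j)"] Suc.prems by simp
    qed (use eq in simp)
    from this[of "r - i"] have "g r = X" using i gr by simp
    then show False using g[of r] r by (simp add: is_glb_def)
  qed
  have ne1: "?xs ! i \<noteq> \<one>" if i: "i \<le> r" for i
  proof
    assume "?xs ! i = \<one>"
    then have "inv (g i) \<otimes> g (Suc i) = \<one>" using i by (simp del: upt_Suc)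
    then have "g i \<otimes> (inv (g i) \<otimes> g (Suc i)) = g i \<otimes> \<one>" by simp
    then show False using ne[OF i] gc[of i] gc[of "Suc i"] i by simp
  qed
  have dX: "\<delta> [^] (- p) \<otimes> (\<delta> [^] p \<otimes> X) = X"
    using X by (simp add: delta_pow_add flip: m_assoc)
  show ?thesis
    unfolding nf_def
  proof (intro conjI)
    show "\<forall>q. \<delta> [^] (- q) \<otimes> (\<delta> [^] p \<otimes> X) \<in> P \<longrightarrow> q \<le> p"
      using inf_maximal_iff[of p "\<delta> [^] p \<otimes> X"] X dX by simp
    show "\<forall>i<length ?xs. is_glb (?xs ! i) (lprod (drop i ?xs)) \<delta> \<and> ?xs ! i \<noteq> \<one>"
      unfolding len less_Suc_eq_le using glb ne1 by blast
    show "set ?xs \<subseteq> carrier G" by (rule xs)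
    show "\<delta> [^] p \<otimes> X = \<delta> [^] p \<otimes> lprod ?xs" unfolding all ..
    show "\<delta> [^] (- p) \<otimes> (\<delta> [^] p \<otimes> X) \<in> P" unfolding dX by (rule X)
  qed
qed

definition rigid :: "'a \<Rightarrow> bool" where
  "rigid x \<longleftrightarrow> (\<exists>p xs. nf x p xs \<and> xs \<noteq> [] \<and>
    nf (x \<otimes> (\<delta> [^] p \<otimes> hd xs \<otimes> \<delta> [^] (- p))) p (xs @ [\<delta> [^] p \<otimes> hd xs \<otimes> \<delta> [^] (- p)]))"

text \<open>Rigidity expressed without normal forms. With \<open>x = \<delta>\<^sup>p \<otimes> X\<close> in normal form of
length \<open>r\<close> and \<open>q = p + r\<close>, the first element is \<open>X\<close> conjugated by a power of
\<open>\<delta>\<close>, and its greatest common divisor with \<open>\<delta>\<close> is the initial factor of \<open>x\<close>; the second is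
the complement of \<open>X\<close> in the \<open>r\<close>-th power of \<open>\<delta>\<close>. That they are coprime says
that the initial factor cannot be absorbed at the end of the normal form.\<close>

definition rigid_data :: "'a \<Rightarrow> int \<Rightarrow> int \<Rightarrow> bool" where
  "rigid_data x p q \<longleftrightarrow> x \<otimes> \<delta> [^] (- p) \<noteq> \<one> \<and> inv x \<otimes> \<delta> [^] q \<noteq> \<one> \<and>
    is_glb \<one> (x \<otimes> \<delta> [^] (- p)) (inv x \<otimes> \<delta> [^] q)"

lemma rigid_imp_data:
  assumes "rigid x"
  shows "\<exists>p q. rigid_data x p q"
proof -
  obtain p xs where nf1: "nf x p xs" and ne: "xs \<noteq> []"
    and nf2: "nf (x \<otimes> (\<delta> [^] p \<otimes> hd xs \<otimes> \<delta> [^] (- p))) p (xs @ [\<delta> [^] p \<otimes> hd xs \<otimes> \<delta> [^] (- p)])"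
    using assms unfolding rigid_def by blast
  define X where "X = lprod xs"
  define r where "r = length xs"
  define y where "y = \<delta> [^] p \<otimes> hd xs \<otimes> \<delta> [^] (- p)"
  have xs: "set xs \<subseteq> carrier G" using nf1 by (simp add: nf_def)
  have r: "r > 0" using ne by (simp add: r_def)
  have Xc: "X \<in> carrier G" using xs by (simp add: X_def)
  have x: "x = \<delta> [^] p \<otimes> X" using nf1 by (simp add: nf_def X_def)
  have hc: "hd xs \<in> carrier G" using xs ne by auto
  have yc: "y \<in> carrier G" using hc by (simp add: y_def)
  have dx: "\<delta> [^] (- p) \<otimes> x = X" using x Xc by (simp add: delta_pow_add flip: m_assoc)
  have XP: "X \<in> P" using nf1 dx by (simp add: nf_def)
  have max: "\<not> \<delta> \<preceq> X"
    using nf1 inf_maximal_iff[of p x] dx XP x Xc by (simp add: nf_def)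
  define a where "a = x \<otimes> \<delta> [^] (- p)"
  define b where "b = inv x \<otimes> \<delta> [^] (p + int r)"
  have a: "a = \<delta> [^] p \<otimes> X \<otimes> \<delta> [^] (- p)" by (simp add: a_def x)
  have b: "b = inv X \<otimes> \<delta> [^] int r"
    using Xc by (simp add: b_def x inv_mult_group m_assoc inv_delta_pow delta_pow_add)
  have ac: "a \<in> carrier G" and bc: "b \<in> carrier G" using Xc by (simp_all add: a b)
  have aP: "a \<in> P" using pos_conj_pow[OF XP, of "- p"] by (simp add: a)
  have bP: "b \<in> P" using nf_glb_prefix[OF nf1, of r] by (simp add: b is_glb_def X_def r_def)
  have h: "is_glb (hd xs) X \<delta>"
    using nf1 ne by (auto simp: nf_def X_def hd_conv_nth)
  have "is_glb (\<delta> [^] p \<otimes> hd xs) (\<delta> [^] p \<otimes> X) (\<delta> [^] p \<otimes> \<delta>)"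
    using h Xc hc by (simp add: is_glb_translate)
  from is_glb_mult_delta_pow[OF this, of "- p"]
  have y: "is_glb y a \<delta>"
    using Xc by (simp add: y_def a delta_pow_add flip: delta_pow_Suc)
  have "is_glb X (X \<otimes> y) (\<delta> [^] int r)"
    using nf_glb_prefix[OF nf2[folded y_def], of r] xs yc by (simp add: lprod_append X_def r_def)
  \<comment> \<open>Translating by \<open>X\<close> turns the prefix condition of the longer normal form into coprimality of \<open>y\<close> and \<open>b\<close>.\<close>
  moreover have "X \<otimes> b = \<delta> [^] int r" using Xc by (simp add: b)
  ultimately have yb: "is_glb \<one> y b" using is_glb_translate[of X \<one> y b] Xc yc bc by simp
  have "is_glb \<one> a b"
  proof (rule is_glb_oneI[OF aP bP])
    fix s assume s: "s \<in> P" "s \<preceq> a" "s \<preceq> b" "s \<preceq> \<delta>"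
    then have "s \<preceq> \<one>" using y yb by (simp add: is_glb_def)
    then show "s = \<one>" using s(1) by (intro le_antisym) simp_all
  qed
  moreover have "a \<noteq> \<one>"
  proof
    assume "a = \<one>"
    then have "is_glb \<one> a \<delta>" by (simp add: is_glb_def pos_one delta_pos)
    then have "y = \<one>" using y is_glb_unique by blast
    then have "\<delta> [^] (- p) \<otimes> y \<otimes> \<delta> [^] p = \<one>" by (simp add: delta_pow_add)
    then have "hd xs = \<one>" using hc by (simp add: y_def m_assoc delta_pow_add) (simp add: delta_pow_add flip: m_assoc)
    then show False using nf1 ne by (auto simp: nf_def hd_conv_nth)
  qed
  moreover have "b \<noteq> \<one>"
  proof
    assume "b = \<one>"
    then have "X \<otimes> b = X" using Xc by simp
    then have "X = \<delta> [^] int r" using Xc by (simp add: b)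
    then show False using max delta_pow_le[of 1 "int r"] r by simp
  qed
  ultimately show ?thesis unfolding rigid_data_def a_def b_def by blast
qed

text \<open>The product of the two positive elements has the length of \<open>\<delta> [^] (q - p)\<close>, and the first of them is nontrivial; hence
the exponent is positive.\<close>

lemma rigid_dataD:
  assumes "rigid_data x p q" "x \<in> carrier G"
  shows "x \<otimes> \<delta> [^] (- p) \<in> P" "inv x \<otimes> \<delta> [^] q \<in> P" "p < q"
proof -
  show a: "x \<otimes> \<delta> [^] (- p) \<in> P" and b: "inv x \<otimes> \<delta> [^] q \<in> P"
    using assms unfolding rigid_data_def is_glb_def by simp_all
  have "len (x \<otimes> \<delta> [^] (- p)) > 0"
    using len_nonneg[OF a] len_eq_0[OF a] assms(1) by (force simp: rigid_data_def)
  moreover have "len (inv x \<otimes> \<delta> [^] q) \<ge> 0" using len_nonneg[OF b] .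
  ultimately have "0 < len (\<delta> [^] (- p)) + len (\<delta> [^] q)" using assms(2) by (simp add: len_mult)
  then have pos: "0 < len (\<delta> [^] (q - p))"
    using len_mult[of "\<delta> [^] (- p)" "\<delta> [^] q"] by (simp add: delta_pow_add)
  show "p < q"
  proof (rule ccontr)
    assume "\<not> p < q"
    then have "\<delta> [^] (p - q) \<in> P" by (intro delta_pow_pos) simp
    then have "0 \<le> len (inv (\<delta> [^] (q - p)))" by (intro len_nonneg) (simp add: inv_delta_pow)
    with pos show False by simp
  qed
qed

lemma pos_delta_swap: "a \<in> P \<Longrightarrow> \<delta> \<preceq> a \<otimes> \<delta>"
  using pos_conj(1)[of a] by (simp add: m_assoc)

text \<open>Both normal forms are produced by \<open>nfI\<close>, applied to \<open>X\<close> and to \<open>X \<otimes> y\<close>, where \<open>y\<close> is the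
initial factor. Coprimality gives that \<open>X\<close> is the greatest lower bound of \<open>X \<otimes> y\<close> and
the power of \<open>\<delta>\<close> whose exponent is the length, so the two elements have the same prefixes up to that length. The bounds on
the infimum and the length hold because neither of two coprime nontrivial positive elements is divisible
by \<open>\<delta>\<close>.\<close>

lemma rigid_if_data:
  assumes "rigid_data x p q" "x \<in> carrier G"
  shows "rigid x"
proof -
  define a where "a = x \<otimes> \<delta> [^] (- p)"
  define b where "b = inv x \<otimes> \<delta> [^] q"
  have aP: "a \<in> P" and bP: "b \<in> P" and pq: "p < q"
    using rigid_dataD[OF assms] by (simp_all add: a_def b_def)
  have ab: "is_glb \<one> a b" "a \<noteq> \<one>" "b \<noteq> \<one>" using assms(1) by (auto simp: rigid_data_def a_def b_def)
  obtain r where r: "q = p + int (Suc r)"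
    using pq by (metis zless_iff_Suc_zadd)
  define X where "X = \<delta> [^] (- p) \<otimes> x"
  have Xc: "X \<in> carrier G" using assms(2) by (simp add: X_def)
  have x: "x = \<delta> [^] p \<otimes> X" using assms(2) by (simp add: X_def delta_pow_add flip: m_assoc)
  have Xa: "X = \<delta> [^] (- p) \<otimes> a \<otimes> \<delta> [^] p"
    using assms(2) by (simp add: X_def a_def m_assoc delta_pow_add)
  have aX: "a = \<delta> [^] p \<otimes> X \<otimes> \<delta> [^] (- p)" by (simp add: x a_def)
  have XP: "X \<in> P" using pos_conj_pow[OF aP] by (simp add: Xa)
  have bX: "b = inv X \<otimes> \<delta> [^] int (Suc r)"
    using assms(2) by (simp add: b_def X_def inv_mult_group m_assoc inv_delta_pow delta_pow_add r)
  have Xb: "X \<otimes> b = \<delta> [^] int (Suc r)" using Xc by (simp add: bX)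
  have delta_not_below: False if "\<delta> \<preceq> a \<or> \<delta> \<preceq> b"
  proof -
    have "a = \<one> \<or> b = \<one>"
    proof (rule ccontr)
      assume n: "\<not> (a = \<one> \<or> b = \<one>)"
      obtain s t where s: "s \<in> P" "s \<noteq> \<one>" "s \<preceq> a" "s \<preceq> \<delta>" and t: "t \<in> P" "t \<noteq> \<one>" "t \<preceq> b" "t \<preceq> \<delta>"
        using atom[OF aP] atom[OF bP] n by auto
      have contra: False if "u \<in> P" "u \<noteq> \<one>" "u \<preceq> a" "u \<preceq> b" for u
      proof -
        have "u \<preceq> \<one>" using that ab(1) by (simp add: is_glb_def)
        then show False using that(1,2) le_antisym[of u \<one>] by simp
      qed
      have up: "u \<preceq> c" if "\<delta> \<preceq> c" "u \<preceq> \<delta>" "u \<in> P" "c \<in> P" for u c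
        using le_trans[OF that(2,1)] that(3,4) by simp
      show False using that
      proof
        assume "\<delta> \<preceq> a"
        then show False using contra[OF t(1,2)] up[OF _ t(4,1) aP] t(3) by blast
      next
        assume "\<delta> \<preceq> b"
        then show False using contra[OF s(1,2)] up[OF _ s(4,1) bP] s(3) by blast
      qed
    qed
    with ab show False by simp
  qed
  have conj_delta: "\<delta> \<preceq> \<delta> [^] p \<otimes> z \<otimes> \<delta> [^] (- p)" if z: "\<delta> \<preceq> z" "z \<in> carrier G" for z
  proof -
    have "\<delta> [^] p \<otimes> (inv \<delta> \<otimes> z) \<otimes> \<delta> [^] (- p) \<in> P" using pos_conj_pow[OF z(1), of "- p"] by simp
    moreover have "\<delta> [^] p \<otimes> inv \<delta> = inv \<delta> \<otimes> \<delta> [^] p"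
      using delta_pow_add[of p "- 1"] delta_pow_add[of "- 1" p] by (simp add: int_pow_neg add.commute)
    ultimately show ?thesis using z by (simp add: m_assoc[symmetric]) 
  qed
  have max: "\<not> \<delta> \<preceq> X" using delta_not_below conj_delta[of X] Xc by (auto simp: aX)
  have Xr: "X \<preceq> \<delta> [^] int (Suc r)" using bP by (simp only: bX)
  have Xr': "\<not> X \<preceq> \<delta> [^] int r"
  proof
    assume "X \<preceq> \<delta> [^] int r"
    from pos_delta_swap[OF this] have "\<delta> \<preceq> b"
      using Xc delta_pow_Suc[of "int r"] by (simp add: bX m_assoc add.commute)
    then show False using delta_not_below by blast
  qed
  define g where "g i = (SOME d. is_glb d X (\<delta> [^] int i))" for i :: nat
  have g: "is_glb (g i) X (\<delta> [^] int i)" for i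
    unfolding g_def using glb_ex[of X "\<delta> [^] int i"] Xc by (auto intro: someI_ex)
  have gc: "g i \<in> carrier G" for i using g[of i] by (simp add: is_glb_def)
  let ?xs = "map (\<lambda>i. inv (g i) \<otimes> g (Suc i)) [0..<Suc r]"
  have nf1: "nf x p ?xs"
    unfolding x by (rule nfI[OF XP max Xr Xr' g])
  have g0: "g 0 = \<one>"
  proof -
    have "is_glb \<one> X (\<delta> [^] int 0)" using XP by (auto simp: is_glb_def pos_one)
    then show ?thesis using g[of 0] is_glb_unique by blast
  qed
  have gr: "g (Suc r) = X"
  proof -
    have "is_glb X X (\<delta> [^] int (Suc r))" using Xc Xr pos_one by (simp add: is_glb_def)
    then show ?thesis using g[of "Suc r"] is_glb_unique by blast
  qed
  have hd: "hd ?xs = g 1" by (simp add: hd_map gc g0 del: upt_Suc)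
  define y where "y = \<delta> [^] p \<otimes> hd ?xs \<otimes> \<delta> [^] (- p)"
  have yc: "y \<in> carrier G" unfolding y_def hd by (simp add: gc)
  have "is_glb (g 1) X \<delta>" using g[of 1] by simp
  then have "is_glb (\<delta> [^] p \<otimes> g 1) (\<delta> [^] p \<otimes> X) (\<delta> [^] p \<otimes> \<delta>)"
    using Xc gc by (simp add: is_glb_translate)
  from is_glb_mult_delta_pow[OF this, of "- p"]
  have y: "is_glb y a \<delta>"
    using Xc by (simp add: y_def hd aX delta_pow_add del: upt_Suc flip: delta_pow_Suc)
  have yP: "y \<in> P"
    using y aP delta_pos unfolding is_glb_def by (metis one_closed one_le pos_carrier)
  have y1: "y \<noteq> \<one>"
  proof
    assume "y = \<one>"
    obtain s where s: "s \<in> P" "s \<noteq> \<one>" "s \<preceq> a" "s \<preceq> \<delta>" using atom[OF aP ab(2)] by auto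
    then have "s \<preceq> \<one>" using y \<open>y = \<one>\<close> by (simp add: is_glb_def)
    then show False using s le_antisym[of s \<one>] by simp
  qed
  have yb: "is_glb \<one> y b"
  proof -
    have "e \<preceq> a" if "e \<in> carrier G" "e \<preceq> y" for e
      by (rule le_trans[OF that(2)]) (use y that yP aP in \<open>simp_all add: is_glb_def\<close>)
    then show ?thesis using ab(1) yP by (simp add: is_glb_def)
  qed
  have glb: "is_glb X (X \<otimes> y) (\<delta> [^] int (Suc r))"
    using yb is_glb_translate[of X \<one> y b] Xc yc bP by (simp add: Xb del: of_nat_Suc)
  let ?X = "X \<otimes> y"
  define g' where "g' i = (if i \<le> Suc r then g i else ?X)" for i
  have XyP: "?X \<in> P" using XP yP by (rule pos_mult)
  have glb_iff: "is_glb d ?X (\<delta> [^] int i) \<longleftrightarrow> is_glb d X (\<delta> [^] int i)" if "i \<le> Suc r" for d i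
  proof -
    have "e \<preceq> ?X \<longleftrightarrow> e \<preceq> X" if e: "e \<in> carrier G" "e \<preceq> \<delta> [^] int i" for e
    proof -
      have "\<delta> [^] int i \<preceq> \<delta> [^] int (Suc r)" by (rule delta_pow_le) (use \<open>i \<le> Suc r\<close> in simp)
      then have "e \<preceq> \<delta> [^] int (Suc r)" by (rule le_trans[OF e(2)]) (use e in simp_all)
      moreover have "X \<preceq> ?X" using Xc yc yP by simp
      ultimately show ?thesis using glb e(1) Xc yc le_trans[of e X ?X]
        unfolding is_glb_def by (meson m_closed)
    qed
    then show ?thesis unfolding is_glb_def by blast
  qed
  have "is_glb (g' i) ?X (\<delta> [^] int i)" if "i \<le> Suc (Suc r)" for i
  proof (cases "i \<le> Suc r")
    case True
    then show ?thesis using g glb_iff by (simp add: g'_def)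
  next
    case False
    then have i: "i = Suc (Suc r)" using that by simp
    have "y \<preceq> \<delta>" using y by (simp add: is_glb_def)
    then have "y \<preceq> b \<otimes> \<delta>" using le_trans[OF _ pos_delta_swap[OF bP], of y] yc bP by simp
    then have "?X \<preceq> X \<otimes> (b \<otimes> \<delta>)" using Xc yc bP by (subst le_translate) simp_all
    then have "?X \<preceq> \<delta> [^] int i"
      using Xb Xc bP delta_pow_Suc[of "int (Suc r)"] by (simp add: i m_assoc[symmetric] add.commute)
    then show ?thesis using XyP False pos_one by (simp add: g'_def is_glb_def)
  qed
  note g' = this
  have max': "\<not> \<delta> \<preceq> ?X"
  proof
    assume "\<delta> \<preceq> ?X"
    moreover have "\<delta> \<preceq> \<delta> [^] int (Suc r)" using delta_pow_le[of 1 "int (Suc r)"] by simp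
    ultimately have "\<delta> \<preceq> X" using glb by (simp add: is_glb_def del: of_nat_Suc)
    with max show False by simp
  qed
  have n: "\<not> ?X \<preceq> \<delta> [^] int (Suc r)"
  proof
    assume "?X \<preceq> \<delta> [^] int (Suc r)"
    then have "?X \<preceq> X" using glb XyP pos_one by (simp add: is_glb_def del: of_nat_Suc)
    then have "y \<preceq> \<one>" using Xc yc le_translate[of y \<one> X] by simp
    then show False using y1 yP le_antisym[of y \<one>] by simp
  qed
  have "nf (\<delta> [^] p \<otimes> ?X) p (map (\<lambda>i. inv (g' i) \<otimes> g' (Suc i)) [0..<Suc (Suc r)])"
    by (rule nfI[OF XyP max' _ n g']) (use g'[of "Suc (Suc r)"] in \<open>simp_all add: g'_def is_glb_def\<close>)
  moreover have "map (\<lambda>i. inv (g' i) \<otimes> g' (Suc i)) [0..<Suc (Suc r)] = ?xs @ [y]"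
    using gr Xc yc by (simp add: g'_def)
  moreover have "\<delta> [^] p \<otimes> ?X = x \<otimes> y" using Xc yc by (simp add: x m_assoc)
  ultimately have "nf (x \<otimes> y) p (?xs @ [y])" by (simp only:)
  moreover have "?xs \<noteq> []" by simp
  ultimately show ?thesis unfolding rigid_def y_def using nf1 by blast
qed

theorem rigid_iff_data: "x \<in> carrier G \<Longrightarrow> rigid x \<longleftrightarrow> (\<exists>p q. rigid_data x p q)"
  using rigid_imp_data rigid_if_data by blast

section \<open>Passing from left to right rigidity\<close>

definition join :: "'a \<Rightarrow> 'a \<Rightarrow> 'a" where
  "join a b = (SOME d. is_lub d a b)"

lemma is_lub_join: "a \<in> carrier G \<Longrightarrow> b \<in> carrier G \<Longrightarrow> is_lub (join a b) a b"
  unfolding join_def by (rule someI_ex) (rule lub_ex)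

lemma join_closed [simp]: "a \<in> carrier G \<Longrightarrow> b \<in> carrier G \<Longrightarrow> join a b \<in> carrier G"
  using is_lub_join by (simp add: is_lub_def)

lemma join_le_iff:
  assumes "a \<in> carrier G" "b \<in> carrier G" "c \<in> carrier G"
  shows "join a b \<preceq> c \<longleftrightarrow> a \<preceq> c \<and> b \<preceq> c"
proof -
  have j: "a \<preceq> join a b" "b \<preceq> join a b" "\<forall>e\<in>carrier G. a \<preceq> e \<longrightarrow> b \<preceq> e \<longrightarrow> join a b \<preceq> e"
    using is_lub_join[OF assms(1,2)] by (simp_all add: is_lub_def)
  have "a \<preceq> c" "b \<preceq> c" if "join a b \<preceq> c"
    using le_trans[OF j(1) that] le_trans[OF j(2) that] assms by simp_all
  then show ?thesis using j(3) assms(3) by blast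
qed

lemma join_mono:
  assumes "a \<preceq> a'" "b \<preceq> b'" "a \<in> carrier G" "b \<in> carrier G" "a' \<in> carrier G" "b' \<in> carrier G"
  shows "join a b \<preceq> join a' b'"
proof -
  have "a' \<preceq> join a' b'" "b' \<preceq> join a' b'"
    using is_lub_join[OF assms(5,6)] by (simp_all add: is_lub_def)
  then have "a \<preceq> join a' b'" "b \<preceq> join a' b'"
    using le_trans[OF assms(1)] le_trans[OF assms(2)] assms by simp_all
  then show ?thesis using assms by (simp add: join_le_iff)
qed

lemma join_translate:
  assumes "a \<in> carrier G" "b \<in> carrier G" "c \<in> carrier G"
  shows "join (c \<otimes> a) (c \<otimes> b) = c \<otimes> join a b"
proof -
  have *: "c \<otimes> d \<preceq> z \<longleftrightarrow> d \<preceq> inv c \<otimes> z" if "d \<in> carrier G" "z \<in> carrier G" for d z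
    using that assms by (simp add: inv_mult_group m_assoc)
  have "is_lub (c \<otimes> join a b) (c \<otimes> a) (c \<otimes> b)"
    using assms is_lub_join[of a b] join_le_iff[of a b] by (simp add: is_lub_def *)
  then show ?thesis by (rule is_lub_unique[OF is_lub_join, rotated 2]) (use assms in simp_all)
qed

lemma join_mult_delta_pow:
  assumes "a \<in> carrier G" "b \<in> carrier G"
  shows "join (a \<otimes> \<delta> [^] (k::int)) (b \<otimes> \<delta> [^] k) = join a b \<otimes> \<delta> [^] k"
proof -
  have *: "d \<otimes> \<delta> [^] k \<preceq> z \<longleftrightarrow> d \<preceq> z \<otimes> \<delta> [^] (- k)" if "d \<in> carrier G" "z \<in> carrier G" for d z
    using that le_mult_delta_pow[of d "z \<otimes> \<delta> [^] (- k)" k]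
    by (simp add: m_assoc delta_pow_add)
  have "is_lub (join a b \<otimes> \<delta> [^] k) (a \<otimes> \<delta> [^] k) (b \<otimes> \<delta> [^] k)"
    using assms is_lub_join[of a b] join_le_iff[of a b] by (simp add: is_lub_def *)
  then show ?thesis by (rule is_lub_unique[OF is_lub_join, rotated 2]) (use assms in simp_all)
qed

text \<open>The heart of the proof. Write \<open>A v = x\<^sup>-\<^sup>1 v \<delta>\<^sup>p\<close> and
\<open>B v = x v \<delta>\<^sup>-\<^sup>q\<close>. These are commuting order automorphisms of the whole group, and the map
\<open>\<rho>\<close> taking \<open>v\<close> to the join of \<open>A v\<close> and \<open>B v\<close> is lower adjoint to the map taking \<open>w\<close> to the meet of
\<open>A\<^sup>-\<^sup>1 w\<close> and \<open>B\<^sup>-\<^sup>1 w\<close>. Left rigidity says that the identity is fixed by the upper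
adjoint, so \<open>\<rho> v \<preceq> \<one>\<close> implies \<open>v \<preceq> \<one>\<close>.

The iterates of \<open>\<rho>\<close> at the identity decrease, and they stay in the set \<open>S\<close> of those \<open>v\<close> for
which the conjugate of \<open>x\<close> by \<open>v\<close> still lies between the powers \<open>p\<close> and \<open>q\<close> of \<open>\<delta>\<close>. There are finitely many
such conjugates, so some iterate \<open>v\<close> is carried by a power of \<open>\<rho>\<close> to \<open>c \<otimes> v\<close>, where
\<open>c\<close> commutes with \<open>x\<close> and hence with \<open>\<rho>\<close>. If \<open>c \<otimes> v\<close> were strictly below \<open>v\<close>, then
the elements \<open>c\<^sup>-\<^sup>m \<otimes> v\<close> would become arbitrarily long; but some iterate of \<open>\<rho>\<close> takes each of
them to \<open>v \<preceq> \<one>\<close>, so they all lie below the identity and have length at most zero. Hence \<open>c \<otimes> v = v\<close>, and the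
decreasing sequence is constant from \<open>v\<close> on.\<close>

theorem exists_join_fixed_point:
  assumes x: "x \<in> carrier G" and data: "rigid_data x p q"
  shows "\<exists>v\<in>carrier G. is_lub v (inv x \<otimes> v \<otimes> \<delta> [^] p) (x \<otimes> v \<otimes> \<delta> [^] (- q))"
proof -
  define A where "A v = inv x \<otimes> v \<otimes> \<delta> [^] p" for v
  define B where "B v = x \<otimes> v \<otimes> \<delta> [^] (- q)" for v
  define \<rho> where "\<rho> v = join (A v) (B v)" for v
  define S where "S = {v \<in> carrier G. A v \<preceq> v \<and> B v \<preceq> v}"
  have Ac [simp]: "A v \<in> carrier G" if "v \<in> carrier G" for v using that x by (simp add: A_def)
  have Bc [simp]: "B v \<in> carrier G" if "v \<in> carrier G" for v using that x by (simp add: B_def)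
  have \<rho>c [simp]: "\<rho> v \<in> carrier G" if "v \<in> carrier G" for v using that by (simp add: \<rho>_def)
  have Amono: "A v \<preceq> A w \<longleftrightarrow> v \<preceq> w" and Bmono: "B v \<preceq> B w \<longleftrightarrow> v \<preceq> w"
    if "v \<in> carrier G" "w \<in> carrier G" for v w using that x by (simp_all add: A_def B_def)
  have AB: "A (B v) = B (A v)" if "v \<in> carrier G" for v
    using that x by (simp add: A_def B_def m_assoc delta_pow_add)
  have Sc: "v \<in> carrier G" if "v \<in> S" for v using that by (simp add: S_def)
  have S1: "\<one> \<in> S"
  proof -
    have "inv (inv x \<otimes> \<delta> [^] p) = \<delta> [^] (- p) \<otimes> x" "inv (x \<otimes> \<delta> [^] (- q)) = \<delta> [^] q \<otimes> inv x"
      using x by (simp_all add: inv_mult_group inv_delta_pow)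
    moreover have "\<delta> [^] (- p) \<otimes> x \<in> P"
      using pos_conj_pow[OF rigid_dataD(1)[OF data x], of p] x
      by (simp add: m_assoc delta_pow_add)
    moreover have "\<delta> [^] q \<otimes> inv x \<in> P"
      using pos_conj_pow[OF rigid_dataD(2)[OF data x], of "- q"] x
      by (simp add: m_assoc delta_pow_add)
    ultimately show ?thesis using x by (simp add: S_def A_def B_def)
  qed
  have \<rho>_le: "\<rho> v \<preceq> v" if "v \<in> S" for v
    using that by (simp add: \<rho>_def S_def join_le_iff)
  have S\<rho>: "\<rho> v \<in> S" if v: "v \<in> S" for v
  proof -
    have c: "v \<in> carrier G" "A v \<preceq> v" "B v \<preceq> v" using v by (simp_all add: S_def)
    have "A (\<rho> v) = join (A (A v)) (A (B v))" "B (\<rho> v) = join (B (A v)) (B (B v))"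
      using c(1) x unfolding A_def B_def \<rho>_def
      by (simp_all add: join_translate join_mult_delta_pow)
    moreover have "A (A v) \<preceq> A v" "A (B v) \<preceq> B v" "B (A v) \<preceq> A v" "B (B v) \<preceq> B v"
      using c Amono[of "A v" v] Bmono[of "A v" v] Amono[of "B v" v] Bmono[of "B v" v] AB[of v]
      by simp_all
    ultimately have "A (\<rho> v) \<preceq> \<rho> v" "B (\<rho> v) \<preceq> \<rho> v"
      using c(1) by (simp_all add: \<rho>_def join_mono)
    then show ?thesis using c(1) by (simp add: S_def)
  qed
  \<comment> \<open>The adjunction, at the fixed point \<open>\<one>\<close> of the upper adjoint.\<close>
  have one: "v \<preceq> \<one>" if v: "v \<in> carrier G" "\<rho> v \<preceq> \<one>" for v
  proof -
    have "A v \<preceq> \<one>" "B v \<preceq> \<one>" using v join_le_iff[of "A v" "B v" \<one>] by (simp_all add: \<rho>_def)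
    moreover have "A (x \<otimes> \<delta> [^] (- p)) = \<one>" "B (inv x \<otimes> \<delta> [^] q) = \<one>"
      using x by (simp_all add: A_def B_def m_assoc delta_pow_add)
    ultimately have "v \<preceq> x \<otimes> \<delta> [^] (- p)" "v \<preceq> inv x \<otimes> \<delta> [^] q"
      using v(1) x Amono[of v "x \<otimes> \<delta> [^] (- p)"] Bmono[of v "inv x \<otimes> \<delta> [^] q"] by simp_all
    then show ?thesis using data v(1) by (simp add: rigid_data_def is_glb_def)
  qed
  define u where "u j = (\<rho> ^^ j) \<one>" for j
  have uS: "u j \<in> S" for j by (induction j) (simp_all add: u_def S1 S\<rho>)
  have uc [simp]: "u j \<in> carrier G" for j using uS Sc by blast
  have u_Suc: "u (Suc j) = \<rho> (u j)" for j by (simp add: u_def)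
  have u_decr: "u (i + j) \<preceq> u i" for i j
  proof (induction j)
    case (Suc j)
    have "u (i + Suc j) \<preceq> u (i + j)" using \<rho>_le[OF uS] by (simp add: u_Suc)
    then show ?case using Suc le_trans uc by blast
  qed (simp add: pos_one)
  have fin: "finite (range (\<lambda>j. inv (u j) \<otimes> x \<otimes> u j))"
  proof -
    define F where "F = (\<Union>m\<in>{0..len (\<delta> [^] (q - p))}. {a \<in> P. len a = m})"
    have finF: "finite F" by (simp add: F_def finite_len)
    have FI: "inv v \<otimes> x \<otimes> v \<in> (\<lambda>a. \<delta> [^] p \<otimes> a) ` F" if "v \<in> S" for v
    proof
      define a where "a = \<delta> [^] (- p) \<otimes> (inv v \<otimes> x \<otimes> v)"
      have vc: "v \<in> carrier G" using that by (rule Sc)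
      have aP: "a \<in> P"
      proof -
        have "inv (A v) \<otimes> v = a" using vc x by (simp add: a_def A_def inv_mult_group m_assoc inv_delta_pow)
        then show ?thesis using that by (simp add: S_def)
      qed
      have "inv (B v) \<otimes> v \<in> P" using that by (simp add: S_def)
      from len_nonneg[OF this] have "len x \<le> len (\<delta> [^] q)"
        using vc x by (simp add: B_def len_mult) (simp add: len_mult inv_delta_pow[symmetric])
      then have "len a \<le> len (\<delta> [^] (q - p))"
        using vc x by (simp add: a_def len_mult delta_pow_add[of q "- p", simplified, symmetric])
      then show "a \<in> F" using aP len_nonneg[OF aP] by (simp add: F_def)
      show "inv v \<otimes> x \<otimes> v = \<delta> [^] p \<otimes> a"
        using vc x by (simp add: a_def delta_pow_add flip: m_assoc)
    qed
    have "range (\<lambda>j. inv (u j) \<otimes> x \<otimes> u j) \<subseteq> (\<lambda>a. \<delta> [^] p \<otimes> a) ` F"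
      using FI[OF uS] by blast
    then show ?thesis using finite_subset[OF _ finite_imageI] finF by blast
  qed
  have "\<not> inj (\<lambda>j. inv (u j) \<otimes> x \<otimes> u j)"
    using fin finite_imageD infinite_UNIV_nat by blast
  then obtain i j where "i < j" "inv (u i) \<otimes> x \<otimes> u i = inv (u j) \<otimes> x \<otimes> u j"
    unfolding inj_def by (metis linorder_neqE_nat)
  then obtain k where ik: "inv (u i) \<otimes> x \<otimes> u i = inv (u (i + Suc k)) \<otimes> x \<otimes> u (i + Suc k)"
    using less_imp_Suc_add[of i j] by auto
  define v where "v = u i"
  define c where "c = u (i + Suc k) \<otimes> inv v"
  have vc [simp]: "v \<in> carrier G" and cc [simp]: "c \<in> carrier G" by (simp_all add: v_def c_def)
  have vS: "v \<in> S" by (simp add: v_def uS)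
  have cx: "c \<otimes> x = x \<otimes> c"
  proof -
    let ?w = "u (i + Suc k)"
    have "?w \<otimes> (inv v \<otimes> x \<otimes> v) \<otimes> inv v = ?w \<otimes> (inv ?w \<otimes> x \<otimes> ?w) \<otimes> inv v"
      using ik by (simp only: v_def)
    then show ?thesis using x vc uc[of "i + Suc k"] by (simp add: c_def m_assoc)
  qed
  have cx': "c \<otimes> inv x = inv x \<otimes> c"
    using commute_inv[OF cx[symmetric]] x by simp
  have \<rho>_transl: "\<rho> (d \<otimes> w) = d \<otimes> \<rho> w"
    if "d \<in> carrier G" "w \<in> carrier G" "d \<otimes> x = x \<otimes> d" "d \<otimes> inv x = inv x \<otimes> d" for d w
  proof -
    have "A (d \<otimes> w) = d \<otimes> A w" "B (d \<otimes> w) = d \<otimes> B w"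
      using that x by (simp_all add: A_def B_def m_assoc[symmetric])
    then show ?thesis using that by (simp add: \<rho>_def join_translate)
  qed
  \<comment> \<open>The backward orbit of \<open>v\<close> under the centralizing element; \<open>\<rho>\<close> to the power \<open>Suc k\<close> moves it one step forward.\<close>
  define e where "e m = inv c [^] m \<otimes> v" for m :: nat
  have ec [simp]: "e m \<in> carrier G" for m by (simp add: e_def)
  have e_Suc: "e m = c \<otimes> e (Suc m)" for m
  proof -
    have "inv c [^] Suc m = inv c \<otimes> inv c [^] m" by (rule nat_pow_Suc2) simp
    then show ?thesis by (simp add: e_def m_assoc del: nat_pow_Suc)
  qed
  have e_one: "e m \<preceq> \<one>" for m
  proof (induction m)
    case 0
    have "u 0 = \<one>" by (simp add: u_def)
    then show ?case using u_decr[of 0 i] by (simp add: e_def v_def)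
  next
    case (Suc m)
    define d where "d = inv c [^] Suc m"
    have dc: "d \<in> carrier G" by (simp add: d_def)
    have dx: "d \<otimes> x = x \<otimes> d" "d \<otimes> inv x = inv x \<otimes> d"
      unfolding d_def
      using group_commutes_pow[OF commute_inv[OF cx cc x] _ x, of "Suc m"]
        group_commutes_pow[OF commute_inv[OF cx' cc inv_closed[OF x]] _ inv_closed[OF x], of "Suc m"]
      by (simp_all only: inv_closed cc)
    have iter: "d \<otimes> u (i + j) \<preceq> \<one> \<Longrightarrow> d \<otimes> v \<preceq> \<one>" for j
    proof (induction j)
      case 0
      then show ?case by (simp add: v_def)
    next
      case (Suc j)
      have "d \<otimes> u (i + Suc j) = \<rho> (d \<otimes> u (i + j))"
        using \<rho>_transl[OF dc uc dx] by (simp add: u_Suc)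
      then have "d \<otimes> u (i + j) \<preceq> \<one>" using Suc.prems one[of "d \<otimes> u (i + j)"] dc by simp
      then show ?case by (rule Suc.IH)
    qed
    have "u (i + Suc k) = c \<otimes> v" using uc[of "i + Suc k"] by (simp add: c_def)
    then have "d \<otimes> u (i + Suc k) = e m"
      by (simp add: d_def e_def m_assoc)
    then show ?case using iter[of "Suc k"] Suc by (simp add: d_def e_def)
  qed
  have "len c = 0"
  proof -
    have cv: "c \<otimes> v \<preceq> v" using u_decr[of i "Suc k"] uc[of "i + Suc k"] by (simp add: c_def v_def)
    then have neg: "len c \<le> 0" using len_nonneg[OF cv] by (simp add: len_mult)
    have len_e: "len (e m) = len v - int m * len c" for m
      by (induction m) (use e_Suc in \<open>simp_all add: e_def len_mult algebra_simps\<close>)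
    have "len (e m) \<le> 0" for m using len_nonneg[OF e_one[of m]] by (simp add: len_mult)
    \<comment> \<open>For \<open>len c \<le> - 1\<close> this value of \<open>m\<close> would make \<open>e m\<close> an element of positive length below \<open>\<one>\<close>.\<close>
    from this[of "nat (1 - len v)"] have "len v - int (nat (1 - len v)) * len c \<le> 0"
      by (simp only: len_e)
    moreover have "len v \<le> 0" using len_nonneg[OF e_one[of 0]] by (simp add: e_def len_mult)
    ultimately show ?thesis using neg mult_left_mono[of "len c" "-1" "1 - len v"] by (force simp: algebra_simps)
  qed
  moreover have cv: "u (i + Suc k) \<preceq> v" using u_decr[of i "Suc k"] by (simp add: v_def)
  moreover have "len (inv (u (i + Suc k)) \<otimes> v) = - len c"
    by (simp add: c_def len_mult)
  ultimately have "inv (u (i + Suc k)) \<otimes> v = \<one>" using len_eq_0[OF cv] by simp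
  then have uv: "u (i + Suc k) = v" using vc uc by (metis inv_cancel(2) r_one)
  have "v \<preceq> \<rho> v" using u_decr[of "Suc i" k] uv by (simp add: u_Suc v_def)
  then have "\<rho> v = v" using \<rho>_le[OF vS] le_antisym[of "\<rho> v" v] by simp
  then have "is_lub v (A v) (B v)" using is_lub_join[of "A v" "B v"] by (simp add: \<rho>_def)
  then show ?thesis unfolding A_def B_def using vc by blast
qed

end

context garside_group begin

text \<open>Inversion is an order-reversing bijection from the group with left divisibility to the group with
right divisibility, so meets and joins of the opposite group come from joins and meets.\<close>

theorem opposite_garside_group: "garside_group (opposite G) P len \<delta>"
proof -
  interpret op: positive_cone "opposite G" P len
  proof (intro positive_cone.intro opposite_group positive_cone_axioms.intro, simp_all only: opposite_simps)
    show "P \<subseteq> carrier G" "\<one> \<in> P" by (rule pos_closed pos_one)+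
    show "b \<otimes> a \<in> P" if "a \<in> P" "b \<in> P" for a b using that pos_mult by blast
    show "len (y \<otimes> x) = len x + len y" if "x \<in> carrier G" "y \<in> carrier G" for x y
      using that by (simp add: len_mult)
    show "0 \<le> len a" if "a \<in> P" for a using that by (rule len_nonneg)
    show "a = \<one>" if "a \<in> P" "len a = 0" for a using that by (rule len_eq_0)
  qed
  show ?thesis
  proof
    show "\<delta> \<in> P" "\<And>m. finite {a \<in> P. len a = m}" by (rule delta_pos finite_len)+
    fix a b assume ab: "a \<in> carrier (opposite G)" "b \<in> carrier (opposite G)"
    show "\<exists>d. op.is_glb d a b"
    proof -
      obtain u where "is_lub u (inv a) (inv b)" using lub_ex[of "inv a" "inv b"] ab by auto
      then have "op.is_glb (inv u) a b" using ab by (auto simp: is_lub_def op.is_glb_def)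
      then show ?thesis by blast
    qed
    show "\<exists>d. op.is_lub d a b"
    proof -
      obtain u where "is_glb u (inv a) (inv b)" using glb_ex[of "inv a" "inv b"] ab by auto
      then have u: "u \<in> carrier G" "inv u \<otimes> inv a \<in> P" "inv u \<otimes> inv b \<in> P"
        "\<forall>e\<in>carrier G. inv e \<otimes> inv a \<in> P \<longrightarrow> inv e \<otimes> inv b \<in> P \<longrightarrow> inv e \<otimes> u \<in> P"
        by (simp_all add: is_glb_def)
      have "e \<otimes> u \<in> P" if "e \<in> carrier G" "e \<otimes> inv a \<in> P" "e \<otimes> inv b \<in> P" for e
        using u(4)[rule_format, of "inv e"] that by simp
      then have "op.is_lub (inv u) a b" using u ab by (simp add: op.is_lub_def)
      then show ?thesis by blast
    qed
  next
    fix a assume a: "a \<in> P"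
    show "inv\<^bsub>opposite G\<^esub> \<delta> \<otimes>\<^bsub>opposite G\<^esub> a \<otimes>\<^bsub>opposite G\<^esub> \<delta> \<in> P"
      "\<delta> \<otimes>\<^bsub>opposite G\<^esub> a \<otimes>\<^bsub>opposite G\<^esub> inv\<^bsub>opposite G\<^esub> \<delta> \<in> P"
      using a pos_conj[OF a] by (simp_all add: m_assoc)
    assume "a \<noteq> \<one>\<^bsub>opposite G\<^esub>"
    then have ne: "a \<noteq> \<one>" by simp
    show "\<exists>s\<in>P. s \<noteq> \<one>\<^bsub>opposite G\<^esub> \<and> inv\<^bsub>opposite G\<^esub> s \<otimes>\<^bsub>opposite G\<^esub> a \<in> P \<and>
        inv\<^bsub>opposite G\<^esub> s \<otimes>\<^bsub>opposite G\<^esub> \<delta> \<in> P"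
      using atom'[OF a ne] by auto
    show "\<exists>s\<in>P. s \<noteq> \<one>\<^bsub>opposite G\<^esub> \<and> a \<otimes>\<^bsub>opposite G\<^esub> inv\<^bsub>opposite G\<^esub> s \<in> P \<and>
        \<delta> \<otimes>\<^bsub>opposite G\<^esub> inv\<^bsub>opposite G\<^esub> s \<in> P"
      using atom[OF a ne] by auto
  qed
qed

text \<open>The fixed-point equation, read for the conjugate \<open>w\<close> of \<open>x\<close> by \<open>v\<close>, says that \<open>\<delta> [^] (- p) \<otimes> w\<close> and
\<open>\<delta> [^] q \<otimes> inv w\<close> have no common right divisor. They are nontrivial because they have the same
lengths as the corresponding elements for \<open>x\<close>.\<close>

theorem rigid_conjugate_opposite_rigid:
  assumes x: "x \<in> carrier G" and "rigid x"
  shows "\<exists>v\<in>carrier G. garside_group.rigid (opposite G) P \<delta> (inv v \<otimes> x \<otimes> v)"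
proof -
  interpret op: garside_group "opposite G" P len \<delta> by (rule opposite_garside_group)
  obtain p q where data: "rigid_data x p q" using assms rigid_iff_data by blast
  obtain v where v: "v \<in> carrier G" and lub: "is_lub v (inv x \<otimes> v \<otimes> \<delta> [^] p) (x \<otimes> v \<otimes> \<delta> [^] (- q))"
    using exists_join_fixed_point[OF x data] by blast
  define w where "w = inv v \<otimes> x \<otimes> v"
  have wc: "w \<in> carrier G" using x v by (simp add: w_def)
  have A: "inv (inv x \<otimes> v \<otimes> \<delta> [^] p) \<otimes> v = \<delta> [^] (- p) \<otimes> w"
    and B: "inv (x \<otimes> v \<otimes> \<delta> [^] (- q)) \<otimes> v = \<delta> [^] q \<otimes> inv w"
    using x v by (simp_all add: w_def inv_mult_group inv_delta_pow m_assoc)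
  have pos: "\<delta> [^] (- p) \<otimes> w \<in> P" "\<delta> [^] q \<otimes> inv w \<in> P"
    using lub unfolding is_lub_def A B by simp_all
  have len_w: "len w = len x" using x v by (simp add: w_def len_mult)
  have "x \<otimes> \<delta> [^] (- p) \<noteq> \<one>" "inv x \<otimes> \<delta> [^] q \<noteq> \<one>" using data by (simp_all add: rigid_data_def)
  then have "len (x \<otimes> \<delta> [^] (- p)) \<noteq> 0" "len (inv x \<otimes> \<delta> [^] q) \<noteq> 0"
    using len_eq_0 rigid_dataD[OF data x] by blast+
  then have "len (\<delta> [^] (- p) \<otimes> w) \<noteq> 0" "len (\<delta> [^] q \<otimes> inv w) \<noteq> 0"
    using x wc by (simp_all add: len_mult len_w)
  then have ne: "\<delta> [^] (- p) \<otimes> w \<noteq> \<one>" "\<delta> [^] q \<otimes> inv w \<noteq> \<one>" by auto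
  have "inv e \<in> P"
    if e: "e \<in> carrier G" "\<delta> [^] (- p) \<otimes> w \<otimes> inv e \<in> P" "\<delta> [^] q \<otimes> inv w \<otimes> inv e \<in> P" for e
  proof -
    have "inv x \<otimes> v \<otimes> \<delta> [^] p \<preceq> v \<otimes> inv e" "x \<otimes> v \<otimes> \<delta> [^] (- q) \<preceq> v \<otimes> inv e"
      using e(2,3) unfolding A[symmetric] B[symmetric] using x v e(1) by (simp_all add: m_assoc)
    moreover have "v \<otimes> inv e \<in> carrier G" using v e(1) by simp
    ultimately have "v \<preceq> v \<otimes> inv e" using lub unfolding is_lub_def by blast
    then show ?thesis using v e(1) by simp
  qed
  then have "op.rigid_data w p q"
    using ne pos wc unfolding op.rigid_data_def op.is_glb_def by simp
  then have "op.rigid w" using op.rigid_if_data wc by simp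
  then show ?thesis using v unfolding w_def by blast
qed

end

section \<open>Positive words and the lemma of Garside\<close>

abbreviation far_apart :: "nat \<Rightarrow> nat \<Rightarrow> bool" where
  "far_apart i j \<equiv> i + 2 \<le> j \<or> j + 2 \<le> i"

abbreviation adjacent :: "nat \<Rightarrow> nat \<Rightarrow> bool" where
  "adjacent i j \<equiv> j = i + 1 \<or> i = j + 1"

text \<open>Positive words are taken on infinitely many generators: the positive relations preserve the set of
letters, so the number of strands enters only when words are mapped to braids.\<close>

inductive pstep :: "nat list \<Rightarrow> nat list \<Rightarrow> bool" where
  far: "far_apart i j \<Longrightarrow> pstep (i # j # u) (j # i # u)"
| braid: "adjacent i j \<Longrightarrow> pstep (i # j # i # u) (j # i # j # u)"
| Cons: "pstep u v \<Longrightarrow> pstep (i # u) (i # v)"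

definition peq :: "nat list \<Rightarrow> nat list \<Rightarrow> bool" (infix "\<approx>" 50) where
  "u \<approx> v \<longleftrightarrow> pstep\<^sup>*\<^sup>* u v"

lemma pstep_sym: "pstep u v \<Longrightarrow> pstep v u"
  by (induction rule: pstep.induct) (auto intro: pstep.intros)

lemma pstep_length: "pstep u v \<Longrightarrow> length u = length v"
  by (induction rule: pstep.induct) auto

lemma pstep_set: "pstep u v \<Longrightarrow> set u = set v"
  by (induction rule: pstep.induct) auto

lemma pstep_append: "pstep u v \<Longrightarrow> pstep (u @ w) (v @ w)"
  by (induction rule: pstep.induct) (auto intro: pstep.intros)

lemma peq_refl [simp, intro]: "u \<approx> u"
  by (simp add: peq_def)

lemma peq_trans [trans]: "u \<approx> v \<Longrightarrow> v \<approx> w \<Longrightarrow> u \<approx> w"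
  by (simp add: peq_def)

lemma peq_sym: "u \<approx> v \<Longrightarrow> v \<approx> u"
  using sympD[OF symp_rtranclp[of pstep]] pstep_sym by (auto simp: peq_def symp_def)

lemma peq_length: "u \<approx> v \<Longrightarrow> length u = length v"
  unfolding peq_def by (induction rule: rtranclp_induct) (auto dest: pstep_length)

lemma peq_set: "u \<approx> v \<Longrightarrow> set u = set v"
  unfolding peq_def by (induction rule: rtranclp_induct) (auto dest: pstep_set)

lemma peq_Cons: "u \<approx> v \<Longrightarrow> i # u \<approx> i # v"
  unfolding peq_def
  by (induction rule: rtranclp_induct) (auto intro: pstep.Cons rtranclp.rtrancl_into_rtrancl)

lemma peq_append_left: "u \<approx> v \<Longrightarrow> w @ u \<approx> w @ v"
  by (induction w) (auto intro: peq_Cons)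

lemma peq_append_right: "u \<approx> v \<Longrightarrow> u @ w \<approx> v @ w"
  unfolding peq_def
  by (induction rule: rtranclp_induct) (auto intro: pstep_append rtranclp.rtrancl_into_rtrancl)

lemma peq_append: "u \<approx> u' \<Longrightarrow> v \<approx> v' \<Longrightarrow> u @ v \<approx> u' @ v'"
  by (meson peq_append_left peq_append_right peq_trans)

lemma peq_far: "far_apart i j \<Longrightarrow> i # j # u \<approx> j # i # u"
  unfolding peq_def by (rule r_into_rtranclp, rule pstep.far)

lemma peq_braid: "adjacent i j \<Longrightarrow> i # j # i # u \<approx> j # i # j # u"
  unfolding peq_def by (rule r_into_rtranclp, rule pstep.braid)

text \<open>The word that completes the letter \<open>i\<close> to the least common multiple of \<open>i\<close> and \<open>j\<close>.\<close>

definition complement :: "nat \<Rightarrow> nat \<Rightarrow> nat list" where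
  "complement i j = (if i = j then [] else if far_apart i j then [j] else [j, i])"

lemma complement_simps:
  "complement i i = []"
  "far_apart i j \<Longrightarrow> complement i j = [j]"
  "adjacent i j \<Longrightarrow> complement i j = [j, i]"
  by (auto simp: complement_def)

lemma complement_lcm: "i # complement i j @ w \<approx> j # complement j i @ w"
proof -
  consider "i = j" | "far_apart i j" | "adjacent i j" by linarith
  then show ?thesis
  proof cases
    case 2
    then have "complement i j = [j]" "complement j i = [i]" by (auto simp: complement_def)
    then show ?thesis using peq_far[OF 2, of w] by simp
  next
    case 3
    then have "complement i j = [j, i]" "complement j i = [i, j]" by (auto simp: complement_def)
    then show ?thesis using peq_braid[OF 3, of w] by simp
  qed (simp add: complement_def)
qed

text \<open>For words \<open>i # u\<close> and \<open>j # v\<close>: both are obtained from the least common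
multiple of their first letters by one and the same extension \<open>w\<close>.\<close>

definition completes :: "nat \<Rightarrow> nat list \<Rightarrow> nat \<Rightarrow> nat list \<Rightarrow> bool" where
  "completes i u j v \<longleftrightarrow> (\<exists>w. u \<approx> complement i j @ w \<and> v \<approx> complement j i @ w)"

lemma completes_sym: "completes i u j v \<Longrightarrow> completes j v i u"
  by (auto simp: completes_def)

lemma completes_far: "completes i u j v \<Longrightarrow> far_apart i j \<Longrightarrow> \<exists>w. u \<approx> j # w \<and> v \<approx> i # w"
  by (auto simp: completes_def complement_def)

lemma completes_adj:
  "completes i u j v \<Longrightarrow> adjacent i j \<Longrightarrow> \<exists>w. u \<approx> j # i # w \<and> v \<approx> i # j # w"
  by (auto simp: completes_def complement_def)

lemma completes_same: "completes i u i v \<Longrightarrow> u \<approx> v"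
  by (auto simp: completes_def complement_def intro: peq_trans peq_sym)

lemma completes_pstep:
  assumes "pstep (i # u) (j # v)"
  shows "completes i u j v"
  using assms
proof cases
  case (far t)
  then show ?thesis by (auto simp: completes_def complement_def)
next
  case (braid t)
  then show ?thesis by (auto simp: completes_def complement_def)
next
  case Cons
  then have "u \<approx> v" by (simp add: peq_def)
  then show ?thesis using Cons by (auto simp: completes_def complement_def peq_sym)
qed

text \<open>The induction hypothesis in the proof of \<open>garside_key\<close>.\<close>

definition key_below :: "nat \<Rightarrow> bool" where
  "key_below L \<longleftrightarrow> (\<forall>p s q t. length s < L \<longrightarrow> p # s \<approx> q # t \<longrightarrow> completes p s q t)"

lemma key_belowD: "key_below L \<Longrightarrow> length s < L \<Longrightarrow> p # s \<approx> q # t \<Longrightarrow> completes p s q t"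
  by (auto simp: key_below_def)

text \<open>The next five lemmas are the cube condition for the first letters \<open>i\<close>, \<open>k\<close>, \<open>j\<close> of three
equivalent words, with \<open>k\<close> the intermediate one. In the names, the three letters \<open>f\<close> (far apart) and \<open>a\<close>
(adjacent) describe the pairs \<open>i, k\<close>, then \<open>k, j\<close>, then \<open>i, j\<close>. The induction hypothesis for
shorter words splits off letters until both tails are expressed by one common word; it is
then brought to the front of both by explicit relations. Exchanging \<open>i\<close> and \<open>j\<close> covers the other
cases, and three distinct letters cannot be pairwise adjacent.\<close>

lemma cube_fff:
  assumes IH: "key_below L"
    and L: "length u = L" and ik: "far_apart i k" and kj: "far_apart k j" and ij: "far_apart i j"
    and 1: "completes i u k w" and 2: "completes k w j v"
  shows "completes i u j v"
proof -
  obtain a where a: "u \<approx> k # a" "w \<approx> i # a" using completes_far[OF 1 ik] by auto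
  obtain b where b: "w \<approx> j # b" "v \<approx> k # b" using completes_far[OF 2 kj] by auto
  have len: "length a < L" using peq_length[OF a(1)] L by simp
  have "completes i a j b" by (rule key_belowD[OF IH len]) (use a b in \<open>meson peq_trans peq_sym\<close>)
  then obtain c where c: "a \<approx> j # c" "b \<approx> i # c" using completes_far ij by blast
  have "u \<approx> j # k # c"
    using a(1) peq_Cons[OF c(1), of k] peq_far[of k j c] kj by (meson peq_trans)
  moreover have "v \<approx> i # k # c"
    using b(2) peq_Cons[OF c(2), of k] peq_far[of k i c] ik by (meson peq_trans)
  ultimately show ?thesis using ij by (auto simp: completes_def complement_simps)
qed

lemma cube_ffa:
  assumes IH: "key_below L"
    and L: "length u = L" and ik: "far_apart i k" and kj: "far_apart k j" and ij: "adjacent i j"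
    and 1: "completes i u k w" and 2: "completes k w j v"
  shows "completes i u j v"
proof -
  obtain a where a: "u \<approx> k # a" "w \<approx> i # a" using completes_far[OF 1 ik] by auto
  obtain b where b: "w \<approx> j # b" "v \<approx> k # b" using completes_far[OF 2 kj] by auto
  have len: "length a < L" using peq_length[OF a(1)] L by simp
  have "completes i a j b" by (rule key_belowD[OF IH len]) (use a b in \<open>meson peq_trans peq_sym\<close>)
  then obtain c where c: "a \<approx> j # i # c" "b \<approx> i # j # c" using completes_adj ij by blast
  have "u \<approx> k # j # i # c" using a(1) peq_Cons[OF c(1), of k] by (rule peq_trans)
  also have "\<dots> \<approx> j # k # i # c" by (rule peq_far) (use kj in auto)
  also have "\<dots> \<approx> j # i # k # c" by (intro peq_Cons peq_far) (use ik in auto)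
  finally have u: "u \<approx> j # i # k # c" .
  have "v \<approx> k # i # j # c" using b(2) peq_Cons[OF c(2), of k] by (rule peq_trans)
  also have "\<dots> \<approx> i # k # j # c" by (rule peq_far) (use ik in auto)
  also have "\<dots> \<approx> i # j # k # c" by (intro peq_Cons peq_far) (use kj in auto)
  finally show ?thesis using ij u by (auto simp: completes_def complement_def)
qed

lemma cube_aff:
  assumes IH: "key_below L"
    and L: "length u = L" and ik: "adjacent i k" and kj: "far_apart k j" and ij: "far_apart i j"
    and 1: "completes i u k w" and 2: "completes k w j v"
  shows "completes i u j v"
proof -
  obtain a where a: "u \<approx> k # i # a" "w \<approx> i # k # a" using completes_adj[OF 1 ik] by auto
  obtain b where b: "w \<approx> j # b" "v \<approx> k # b" using completes_far[OF 2 kj] by auto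
  have len: "length (k # a) < L" "length a < L" using peq_length[OF a(1)] L by auto
  have "completes i (k # a) j b" by (rule key_belowD[OF IH len(1)]) (use a b in \<open>meson peq_trans peq_sym\<close>)
  then obtain c where c: "k # a \<approx> j # c" "b \<approx> i # c" using completes_far ij by blast
  obtain d where d: "a \<approx> j # d" "c \<approx> k # d" using completes_far[OF key_belowD[OF IH len(2) c(1)] kj] by auto
  have "u \<approx> k # i # j # d" using a(1) by (rule peq_trans) (intro peq_Cons d)
  also have "\<dots> \<approx> k # j # i # d" by (intro peq_Cons peq_far) (use ij in auto)
  also have "\<dots> \<approx> j # k # i # d" by (intro peq_Cons peq_far) (use kj in auto)
  finally have u: "u \<approx> j # k # i # d" .
  have "v \<approx> k # i # c" using b(2) peq_Cons[OF c(2), of k] by (rule peq_trans)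
  also have "\<dots> \<approx> k # i # k # d" by (intro peq_Cons d)
  also have "\<dots> \<approx> i # k # i # d" by (intro peq_Cons peq_braid) (use ik in auto)
  finally show ?thesis using ij u by (auto simp: completes_def complement_def)
qed

lemma cube_aaf:
  assumes IH: "key_below L"
    and L: "length u = L" and ik: "adjacent i k" and kj: "adjacent k j" and ij: "far_apart i j"
    and 1: "completes i u k w" and 2: "completes k w j v"
  shows "completes i u j v"
proof -
  have ki: "adjacent k i" using ik by auto
  obtain a where a: "u \<approx> k # i # a" "w \<approx> i # k # a" using completes_adj[OF 1 ik] by auto
  obtain b where b: "w \<approx> j # k # b" "v \<approx> k # j # b" using completes_adj[OF 2 kj] by auto
  have len: "length (k # a) < L" "length a < L" using peq_length[OF a(1)] L by auto
  have "completes i (k # a) j (k # b)"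
    by (rule key_belowD[OF IH len(1)]) (use a b in \<open>meson peq_trans peq_sym\<close>)
  then obtain c where c: "k # a \<approx> j # c" "k # b \<approx> i # c" using completes_far ij by blast
  obtain d where d: "a \<approx> j # k # d" "c \<approx> k # j # d"
    using completes_adj[OF key_belowD[OF IH len(2) c(1)] kj] by auto
  have len': "length b < L" "length (j # d) < L"
    using peq_length[OF c(1)] peq_length[OF c(2)] peq_length[OF d(1)] len by auto
  obtain e where e: "b \<approx> i # k # e" "c \<approx> k # i # e"
    using completes_adj[OF key_belowD[OF IH len'(1) c(2)] ki] by auto
  have "k # j # d \<approx> k # i # e" using d e by (meson peq_trans peq_sym)
  then have de: "j # d \<approx> i # e" using key_belowD[OF IH len'(2)] completes_same by blast
  obtain f where f: "d \<approx> i # f" "e \<approx> j # f"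
    using completes_far[OF key_belowD[OF IH _ de]] ij len'(2) by auto
  have "u \<approx> k # i # j # k # d" using a(1) by (rule peq_trans) (intro peq_Cons d)
  also have "\<dots> \<approx> k # i # j # k # i # f" by (intro peq_Cons f)
  also have "\<dots> \<approx> k # j # i # k # i # f" by (intro peq_Cons peq_far) (use ij in auto)
  also have "\<dots> \<approx> k # j # k # i # k # f" by (intro peq_Cons peq_braid) (use ik in auto)
  also have "\<dots> \<approx> j # k # j # i # k # f" by (intro peq_Cons peq_braid) (use kj in auto)
  finally have u: "u \<approx> j # k # j # i # k # f" .
  have "v \<approx> k # j # i # k # e" using b(2) by (rule peq_trans) (intro peq_Cons e)
  also have "\<dots> \<approx> k # j # i # k # j # f" by (intro peq_Cons f)
  also have "\<dots> \<approx> k # i # j # k # j # f" by (intro peq_Cons peq_far) (use ij in auto)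
  also have "\<dots> \<approx> k # i # k # j # k # f" by (intro peq_Cons peq_braid) (use kj in auto)
  also have "\<dots> \<approx> i # k # i # j # k # f" by (intro peq_Cons peq_braid) (use ik in auto)
  also have "\<dots> \<approx> i # k # j # i # k # f" by (intro peq_Cons peq_far) (use ij in auto)
  finally show ?thesis using ij u by (auto simp: completes_def complement_def)
qed

lemma cube_afa:
  assumes IH: "key_below L"
    and L: "length u = L" and ik: "adjacent i k" and kj: "far_apart k j" and ij: "adjacent i j"
    and 1: "completes i u k w" and 2: "completes k w j v"
  shows "completes i u j v"
proof -
  obtain a where a: "u \<approx> k # i # a" "w \<approx> i # k # a" using completes_adj[OF 1 ik] by auto
  obtain b where b: "w \<approx> j # b" "v \<approx> k # b" using completes_far[OF 2 kj] by auto
  have len: "length (k # a) < L" "length a < L" using peq_length[OF a(1)] L by auto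
  have "completes i (k # a) j b" by (rule key_belowD[OF IH len(1)]) (use a b in \<open>meson peq_trans peq_sym\<close>)
  then obtain c where c: "k # a \<approx> j # i # c" "b \<approx> i # j # c" using completes_adj ij by blast
  obtain d where d: "a \<approx> j # d" "i # c \<approx> k # d"
    using completes_far[OF key_belowD[OF IH len(2) c(1)] kj] by auto
  have len': "length c < L" using peq_length[OF c(1)] len by auto
  obtain e where e: "c \<approx> k # i # e" "d \<approx> i # k # e"
    using completes_adj[OF key_belowD[OF IH len' d(2)] ik] by auto
  have "u \<approx> k # i # j # d" using a(1) by (rule peq_trans) (intro peq_Cons d)
  also have "\<dots> \<approx> k # i # j # i # k # e" by (intro peq_Cons e)
  also have "\<dots> \<approx> k # j # i # j # k # e" by (intro peq_Cons peq_braid) (use ij in auto)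
  also have "\<dots> \<approx> j # k # i # j # k # e" by (intro peq_Cons peq_far) (use kj in auto)
  also have "\<dots> \<approx> j # k # i # k # j # e" by (intro peq_Cons peq_far) (use kj in auto)
  also have "\<dots> \<approx> j # i # k # i # j # e" by (intro peq_Cons peq_braid) (use ik in auto)
  finally have u: "u \<approx> j # i # k # i # j # e" .
  have "v \<approx> k # i # j # c" using b(2) by (rule peq_trans) (intro peq_Cons c)
  also have "\<dots> \<approx> k # i # j # k # i # e" by (intro peq_Cons e)
  also have "\<dots> \<approx> k # i # k # j # i # e" by (intro peq_Cons peq_far) (use kj in auto)
  also have "\<dots> \<approx> i # k # i # j # i # e" by (intro peq_Cons peq_braid) (use ik in auto)
  also have "\<dots> \<approx> i # k # j # i # j # e" by (intro peq_Cons peq_braid) (use ij in auto)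
  also have "\<dots> \<approx> i # j # k # i # j # e" by (intro peq_Cons peq_far) (use kj in auto)
  finally show ?thesis using ij u by (auto simp: completes_def complement_def)
qed

lemma completes_trans:
  assumes IH: "key_below L"
    and L: "length u = L" "length v = L"
    and uw: "completes i u k w" and wv: "completes k w j v"
  shows "completes i u j v"
proof (cases "i = k \<or> k = j \<or> i = j")
  case True
  consider "i = k" | "k = j" | "i = j" "i \<noteq> k" using True by blast
  then show ?thesis
  proof cases
    assume "i = k"
    moreover from this have "u \<approx> w" using uw completes_same by simp
    ultimately show ?thesis using wv unfolding completes_def by (meson peq_trans peq_sym)
  next
    assume "k = j"
    moreover from this have "w \<approx> v" using wv completes_same by simp
    ultimately show ?thesis using uw unfolding completes_def by (meson peq_trans peq_sym)
  next
    assume ij: "i = j" "i \<noteq> k"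
    obtain a where a: "u \<approx> complement i k @ a" "w \<approx> complement k i @ a"
      using uw by (auto simp: completes_def)
    obtain b where b: "w \<approx> complement k i @ b" "v \<approx> complement i k @ b"
      using wv ij by (auto simp: completes_def)
    have eq: "complement k i @ a \<approx> complement k i @ b" using a b by (meson peq_trans peq_sym)
    have len: "length (complement i k @ a) = L" using peq_length[OF a(1)] L by simp
    have cancel: "s \<approx> t" if "p # s \<approx> p # t" "length s < L" for p s t
      using key_belowD[OF IH that(2) that(1)] by (rule completes_same)
    have "a \<approx> b"
    proof (cases "far_apart i k")
      case True
      then have "complement k i = [i]" "complement i k = [k]" by (auto simp: complement_def)
      then show ?thesis using eq len by (auto intro: cancel)
    next
      case False
      then have c: "complement k i = [i, k]" "complement i k = [k, i]" using ij by (auto simp: complement_def)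
      then have "k # a \<approx> k # b" using eq len by (auto intro: cancel)
      then show ?thesis using c len by (auto intro: cancel)
    qed
    then have "u \<approx> v" using a b by (meson peq_trans peq_sym peq_append_left)
    then show ?thesis using ij peq_sym by (auto simp: completes_def complement_def)
  qed
next
  case False
  note sym = completes_sym[OF wv] completes_sym[OF uw]
  define F where "F p q \<longleftrightarrow> far_apart p q" for p q
  define A where "A p q \<longleftrightarrow> adjacent p q" for p q
  note [simp] = F_def A_def
  have comm: "F p q = F q p" "A p q = A q p" for p q by auto
  have alt: "F p q \<or> A p q" if "p \<noteq> q" for p q using that by auto
  have ikj: "F i j" if "A i k" "A k j" using that False by auto
  consider "F i k" "F k j" "F i j" | "F i k" "F k j" "A i j" | "A i k" "F k j" "F i j"
    | "A i k" "F k j" "A i j" | "A i k" "A k j" "F i j"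
    | "A j k" "F k i" "F j i" | "A j k" "F k i" "A j i"
    using alt[of i k] alt[of k j] alt[of i j] False ikj comm by metis
  then show ?thesis
  proof cases
    case 1
    show ?thesis by (rule cube_fff[OF IH L(1) 1[unfolded F_def A_def] uw wv])
  next
    case 2
    show ?thesis by (rule cube_ffa[OF IH L(1) 2[unfolded F_def A_def] uw wv])
  next
    case 3
    show ?thesis by (rule cube_aff[OF IH L(1) 3[unfolded F_def A_def] uw wv])
  next
    case 4
    show ?thesis by (rule cube_afa[OF IH L(1) 4[unfolded F_def A_def] uw wv])
  next
    case 5
    show ?thesis by (rule cube_aaf[OF IH L(1) 5[unfolded F_def A_def] uw wv])
  next
    case 6
    show ?thesis by (rule completes_sym[OF cube_aff[OF IH L(2) 6[unfolded F_def A_def] sym]])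
  next
    case 7
    show ?thesis by (rule completes_sym[OF cube_afa[OF IH L(2) 7[unfolded F_def A_def] sym]])
  qed
qed

text \<open>Garside's lemma: a common multiple of two generators is a multiple of their least common
multiple, already in the monoid given by the positive relations. The proof is by induction on the length and, inside, along a chain of elementary
relations from \<open>i # u\<close> to \<open>j # v\<close>; the cube condition composes the consecutive steps
of the chain.\<close>

theorem garside_key:
  assumes "i # u \<approx> j # v"
  shows "completes i u j v"
  using assms
proof (induction "length u" arbitrary: i u j v rule: less_induct)
  case less
  have IH: "key_below (length u)"
    unfolding key_below_def by (intro allI impI) (rule less.hyps)
  have "pstep\<^sup>*\<^sup>* (i # u) (j # v)" using less.prems by (simp add: peq_def)
  moreover have "case z of [] \<Rightarrow> True | k # w \<Rightarrow> completes i u k w" if "pstep\<^sup>*\<^sup>* (i # u) z" for z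
    using that
  proof (induction rule: rtranclp_induct)
    case base
    then show ?case by (auto simp: completes_def complement_def)
  next
    case (step y z)
    have "i # u \<approx> y" "i # u \<approx> z" using step.hyps by (auto simp: peq_def)
    then obtain k w j' v' where kw: "y = k # w" "z = j' # v'" and len: "length v' = length u"
      using peq_length[of "i # u" y] peq_length[of "i # u" z] by (cases y; cases z) auto
    have "completes i u k w" using step.IH kw by simp
    moreover have "completes k w j' v'" using step.hyps kw by (simp add: completes_pstep)
    ultimately have "completes i u j' v'" using completes_trans[OF IH HOL.refl len] by blast
    then show ?case by (simp add: kw)
  qed
  ultimately have "case j # v of [] \<Rightarrow> True | k # w \<Rightarrow> completes i u k w" by blast
  then show ?case by simp
qed

lemma peq_cancel_left: "w @ u \<approx> w @ v \<Longrightarrow> u \<approx> v"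
proof (induction w)
  case (Cons i w)
  then have "i # w @ u \<approx> i # w @ v" by simp
  then show ?case using Cons.IH completes_same[OF garside_key] by blast
qed simp

section \<open>The fundamental word\<close>

text \<open>The rotation of a braid by a half turn, which is what conjugation by \<open>\<Delta>\<close> does.\<close>

definition flip :: "nat \<Rightarrow> nat list \<Rightarrow> nat list" where
  "flip n = map (\<lambda>i. n - i)"

definition down :: "nat \<Rightarrow> nat list" where
  "down k = rev [1..<Suc k]"

definition delta_word :: "nat \<Rightarrow> nat list" where
  "delta_word n = concat (map down [1..<n])"

lemma flip_simps [simp]:
  "flip n [] = []" "flip n (i # u) = (n - i) # flip n u" "flip n (u @ v) = flip n u @ flip n v"
  by (simp_all add: flip_def)

lemma down_simps [simp]: "down 0 = []" "down (Suc k) = Suc k # down k"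
  by (simp_all add: down_def)

lemma set_down [simp]: "set (down k) = {1..k}"
  by (auto simp: down_def)

lemma delta_word_simps [simp]:
  "delta_word 0 = []" "delta_word (Suc 0) = []"
  "delta_word (Suc (Suc n)) = delta_word (Suc n) @ down (Suc n)"
  by (simp_all add: delta_word_def del: down_simps)

lemma set_delta_word: "set (delta_word n) \<subseteq> {1..<n}"
  by (auto simp: delta_word_def)

lemma peq_commute_far:
  "\<forall>j\<in>set w. far_apart i j \<Longrightarrow> i # w @ u \<approx> w @ i # u"
proof (induction w)
  case (Cons j w)
  have "i # (j # w) @ u \<approx> j # i # w @ u" using Cons.prems peq_far[of i j "w @ u"] by simp
  also have "\<dots> \<approx> j # w @ i # u" using Cons by (intro peq_Cons) simp
  finally show ?case by simp
qed simp

lemma down_slide: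
  assumes "2 \<le> i" "i \<le> k"
  shows "down k @ [i] \<approx> (i - 1) # down k"
  using assms(2)
proof (induction k rule: dec_induct)
  case base
  obtain j where j: "i = Suc (Suc j)" using assms(1) by (metis add_2_eq_Suc le_Suc_ex)
  have "down i @ [i] = i # (i - 1) # down j @ [i]" by (simp add: j)
  also have "\<dots> \<approx> i # (i - 1) # i # down j"
  proof -
    have "i # down j @ [] \<approx> down j @ [i]" by (rule peq_commute_far) (simp add: j)
    then show ?thesis by (intro peq_Cons) (simp add: peq_sym)
  qed
  also have "\<dots> \<approx> (i - 1) # i # (i - 1) # down j" by (rule peq_braid) (use j in simp)
  finally show ?case by (simp add: j)
next
  case (step k)
  have "down (Suc k) @ [i] = Suc k # down k @ [i]" by simp
  also have "\<dots> \<approx> Suc k # (i - 1) # down k" by (intro peq_Cons step.IH)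
  also have "\<dots> \<approx> (i - 1) # Suc k # down k" by (rule peq_far) (use step assms in auto)
  finally show ?case by simp
qed

lemma down_down:
  "down k @ down (Suc k) @ [1] \<approx> Suc k # down k @ down (Suc k)"
proof (induction k)
  case (Suc k)
  let ?d = "down k @ down (Suc k)"
  have swap: "down (Suc k) @ down (Suc (Suc k)) @ u \<approx> Suc k # Suc (Suc k) # ?d @ u" for u
  proof -
    have "Suc k # Suc (Suc k) # down k @ down (Suc k) @ u \<approx>
        Suc k # down k @ Suc (Suc k) # down (Suc k) @ u"
      by (intro peq_Cons peq_commute_far) auto
    then show ?thesis using peq_sym by simp
  qed
  have "down (Suc k) @ down (Suc (Suc k)) @ [1] \<approx> Suc k # Suc (Suc k) # ?d @ [1]" by (rule swap)
  also have "\<dots> \<approx> Suc k # Suc (Suc k) # Suc k # ?d"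
    using Suc.IH by (intro peq_Cons) simp
  also have "\<dots> \<approx> Suc (Suc k) # Suc k # Suc (Suc k) # ?d" by (rule peq_braid) simp
  also have "\<dots> \<approx> Suc (Suc k) # down (Suc k) @ down (Suc (Suc k))"
    using swap[of "[]"] peq_sym by (intro peq_Cons) simp
  finally show ?case by simp
qed simp

text \<open>Sliding a letter \<open>i \<ge> 2\<close> through the last descending block reduces its index by one and leaves the case of
one strand less. The letter \<open>1\<close> is absorbed by the last two blocks, from which \<open>n - 1\<close> comes out, and this commutes with all earlier blocks.\<close>

lemma delta_word_letter:
  "1 \<le> i \<Longrightarrow> i < n \<Longrightarrow> delta_word n @ [i] \<approx> (n - i) # delta_word n"
proof (induction n arbitrary: i rule: less_induct)
  case (less n)
  then obtain m where "n = 2 + m" using le_Suc_ex[of 2 n] by auto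
  then have m: "n = Suc (Suc m)" by simp
  show ?case
  proof (cases "i = 1")
    case False
    have "delta_word n @ [i] = delta_word (Suc m) @ down (Suc m) @ [i]" by (simp add: m del: down_simps)
    also have "\<dots> \<approx> delta_word (Suc m) @ (i - 1) # down (Suc m)"
      using False less.prems m by (intro peq_append_left down_slide) auto
    also have "\<dots> = (delta_word (Suc m) @ [i - 1]) @ down (Suc m)" by simp
    also have "\<dots> \<approx> ((Suc m - (i - 1)) # delta_word (Suc m)) @ down (Suc m)"
      using False less.prems m by (intro peq_append_right less.IH) auto
    also have "\<dots> = (n - i) # delta_word n" using False less.prems m by (simp del: down_simps)
    finally show ?thesis .
  next
    case True
    show ?thesis
    proof (cases m)
      case 0
      then show ?thesis using True m by simp
    next
      case (Suc l)
      have "delta_word n @ [i] = delta_word (Suc l) @ down (Suc l) @ down (Suc (Suc l)) @ [1]"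
        using True by (simp add: m Suc del: down_simps)
      also have "\<dots> \<approx> delta_word (Suc l) @ Suc (Suc l) # down (Suc l) @ down (Suc (Suc l))"
        by (intro peq_append_left down_down)
      also have "\<dots> \<approx> Suc (Suc l) # delta_word (Suc l) @ down (Suc l) @ down (Suc (Suc l))"
        by (intro peq_sym[OF peq_commute_far]) (use set_delta_word[of "Suc l"] in auto)
      also have "\<dots> = (n - i) # delta_word n" using True by (simp add: m Suc del: down_simps)
      finally show ?thesis .
    qed
  qed
qed

lemma flip_flip: "set u \<subseteq> {1..<n} \<Longrightarrow> flip n (flip n u) = u"
  by (induction u) auto

lemma set_flip: "set u \<subseteq> {1..<n} \<Longrightarrow> set (flip n u) \<subseteq> {1..<n}"
  by (induction u) auto

lemma flip_peq: "u \<approx> v \<Longrightarrow> set u \<subseteq> {1..<n} \<Longrightarrow> flip n u \<approx> flip n v"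
  unfolding peq_def
proof (induction rule: rtranclp_induct)
  case (step v w)
  have step_flip: "pstep v w \<Longrightarrow> set v \<subseteq> {1..<n} \<Longrightarrow> pstep (flip n v) (flip n w)" for v w
  proof (induction rule: pstep.induct)
    case (far i j u)
    then show ?case unfolding flip_simps by (intro pstep.far) auto
  next
    case (braid i j u)
    then show ?case unfolding flip_simps by (intro pstep.braid) auto
  qed (auto intro: pstep.Cons)
  have "set v \<subseteq> {1..<n}"
    using step.hyps(1) step.prems peq_set[of u v] by (simp add: peq_def)
  then have "pstep (flip n v) (flip n w)" using step.hyps(2) step_flip by blast
  then show ?case using step.IH[OF step.prems] by simp
qed simp

lemma delta_word_commute:
  "set u \<subseteq> {1..<n} \<Longrightarrow> delta_word n @ flip n u \<approx> u @ delta_word n"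
proof (induction u)
  case (Cons i u)
  have "delta_word n @ flip n (i # u) = (delta_word n @ [n - i]) @ flip n u" by simp
  also have "\<dots> \<approx> ((n - (n - i)) # delta_word n) @ flip n u"
    using Cons.prems by (intro peq_append_right delta_word_letter) auto
  also have "\<dots> = i # delta_word n @ flip n u" using Cons.prems by simp
  also have "\<dots> \<approx> i # u @ delta_word n" using Cons by (intro peq_Cons) simp
  finally show ?case by simp
qed simp

text \<open>Moving the whole word through itself gives two products that start with it; cancel on the left.\<close>

lemma flip_delta_word: "flip n (delta_word n) \<approx> delta_word n"
  using delta_word_commute[OF set_delta_word] peq_cancel_left by blast

text \<open>Each letter below \<open>n - 1\<close> already divides the word on one strand less, which is a prefix; the last letter is the first
letter of the flipped word.\<close>

lemma letter_divides_delta_word: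
  "1 \<le> i \<Longrightarrow> i < n \<Longrightarrow> \<exists>s. set s \<subseteq> {1..<n} \<and> i # s \<approx> delta_word n"
proof (induction n)
  case (Suc n)
  then obtain m where m: "n = Suc m" by (cases n) auto
  show ?case
  proof (cases "i < n")
    case True
    then obtain s where s: "set s \<subseteq> {1..<n}" "i # s \<approx> delta_word n" using Suc by auto
    have "i # (s @ down n) \<approx> delta_word (Suc n)"
      using peq_append_right[OF s(2), of "down n"] by (simp add: m del: down_simps)
    moreover have "set (s @ down n) \<subseteq> {1..<Suc n}" using s(1) by auto
    ultimately show ?thesis by blast
  next
    case False
    then have i: "i = n" using Suc.prems by simp
    obtain t where t: "delta_word (Suc n) = 1 # t"
    proof -
      have "\<exists>t. delta_word (Suc (Suc m)) = 1 # t"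
      proof (induction m)
        case (Suc m)
        then obtain t where "delta_word (Suc (Suc m)) = 1 # t" by blast
        then have "delta_word (Suc (Suc (Suc m))) = 1 # (t @ down (Suc (Suc m)))"
          by (simp only: delta_word_simps(3)[of "Suc m"] append_Cons)
        then show ?case by blast
      qed simp
      then show ?thesis using that m by blast
    qed
    have "n # flip (Suc n) t \<approx> delta_word (Suc n)"
      using flip_delta_word[of "Suc n"] by (simp add: t)
    moreover have "set (flip (Suc n) t) \<subseteq> {1..<Suc n}"
      using set_delta_word[of "Suc n"] t by (intro set_flip) auto
    ultimately show ?thesis using i by blast
  qed
qed simp

section \<open>The braid monoid embeds in the braid group\<close>

text \<open>Without this, the simplifier changes the lower bound in \<open>{1..<n}\<close>, the set of
letters, and facts about it no longer match.\<close>

declare One_nat_def [simp del]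

definition pos_word :: "nat list \<Rightarrow> braid_word" where
  "pos_word = map (Pair True)"

lemma pos_word_simps [simp]:
  "pos_word [] = []" "pos_word (i # u) = (True, i) # pos_word u"
  "pos_word (u @ v) = pos_word u @ pos_word v"
  by (simp_all add: pos_word_def)

lemma pos_word_words [simp]: "pos_word u \<in> braid_words n \<longleftrightarrow> set u \<subseteq> {1..<n}"
  by (induction u) auto

definition delta_power :: "nat \<Rightarrow> nat \<Rightarrow> nat list" where
  "delta_power n k = concat (replicate k (delta_word n))"

lemma delta_power_simps [simp]:
  "delta_power n 0 = []" "delta_power n (Suc k) = delta_word n @ delta_power n k"
  by (simp_all add: delta_power_def)

lemma delta_power_add: "delta_power n (k + l) = delta_power n k @ delta_power n l"
  by (induction k) simp_all

lemma set_delta_power: "set (delta_power n k) \<subseteq> {1..<n}"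
  using set_delta_word by (induction k) auto

abbreviation flips :: "nat \<Rightarrow> nat \<Rightarrow> nat list \<Rightarrow> nat list" where
  "flips n k \<equiv> flip n ^^ k"

lemma flips_Nil [simp]: "flips n k [] = []"
  by (induction k) simp_all

lemma flips_append: "flips n k (u @ v) = flips n k u @ flips n k v"
  by (induction k) simp_all

lemma set_flips: "set u \<subseteq> {1..<n} \<Longrightarrow> set (flips n k u) \<subseteq> {1..<n}"
  by (induction k) (simp_all add: set_flip)

lemma flips_peq: "u \<approx> v \<Longrightarrow> set u \<subseteq> {1..<n} \<Longrightarrow> flips n k u \<approx> flips n k v"
  by (induction k) (simp_all add: flip_peq set_flips)

lemma flips_add: "flips n k (flips n l u) = flips n (k + l) u"
  by (simp add: funpow_add)

lemma flip_delta_power: "flip n (delta_power n k) \<approx> delta_power n k"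
  by (induction k) (simp_all add: peq_append flip_delta_word)

lemma flips_delta_power: "flips n l (delta_power n k) \<approx> delta_power n k"
proof (induction l)
  case (Suc l)
  have "flips n (Suc l) (delta_power n k) \<approx> flip n (delta_power n k)"
    using flip_peq[OF Suc set_flips[OF set_delta_power]] by simp
  then show ?case using flip_delta_power peq_trans by blast
qed simp

lemma delta_power_commute:
  "set u \<subseteq> {1..<n} \<Longrightarrow> delta_power n k @ u \<approx> flips n k u @ delta_power n k"
proof (induction k arbitrary: u)
  case (Suc k)
  have "delta_power n (Suc k) @ u = delta_word n @ delta_power n k @ u" by simp
  also have "\<dots> \<approx> delta_word n @ flips n k u @ delta_power n k"
    using Suc by (intro peq_append_left) simp
  also have "\<dots> = (delta_word n @ flip n (flips n (Suc k) u)) @ delta_power n k"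
    using Suc.prems by (simp add: flip_flip set_flips)
  also have "\<dots> \<approx> (flips n (Suc k) u @ delta_word n) @ delta_power n k"
    using Suc.prems by (intro peq_append_right delta_word_commute set_flips)
  finally show ?case by simp
qed simp

definition letter_complement :: "nat \<Rightarrow> nat \<Rightarrow> nat list" where
  "letter_complement n i = (SOME s. set s \<subseteq> {1..<n} \<and> i # s \<approx> delta_word n)"

lemma letter_complement:
  assumes "i \<in> {1..<n}"
  shows "set (letter_complement n i) \<subseteq> {1..<n}" "i # letter_complement n i \<approx> delta_word n"
  using someI_ex[OF letter_divides_delta_word[of i n]] assms
  unfolding letter_complement_def by auto

lemma letter_complement_right:
  assumes "i \<in> {1..<n}"
  shows "flip n (letter_complement n i) @ [i] \<approx> delta_word n"
proof -
  let ?s = "letter_complement n i"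
  note s = letter_complement[OF assms]
  have "i # ?s @ [n - i] \<approx> delta_word n @ [n - i]"
    using peq_append_right[OF s(2), of "[n - i]"] by simp
  also have "\<dots> \<approx> i # delta_word n"
    using delta_word_letter[of "n - i" n] assms by auto
  finally have "?s @ [n - i] \<approx> delta_word n"
    using peq_cancel_left[of "[i]"] by simp
  moreover have "set (?s @ [n - i]) \<subseteq> {1..<n}" using s(1) assms by auto
  ultimately have "flip n (?s @ [n - i]) \<approx> flip n (delta_word n)" by (rule flip_peq)
  then have "flip n ?s @ [i] \<approx> flip n (delta_word n)" using assms by simp
  then show ?thesis using flip_delta_word peq_trans by blast
qed

definition negs :: "braid_word \<Rightarrow> nat" where
  "negs w = length (filter (\<lambda>x. \<not> fst x) w)"

lemma negs_simps [simp]: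
  "negs [] = 0" "negs ((e, i) # w) = (if e then 0 else 1) + negs w" "negs (u @ v) = negs u + negs v"
  by (simp_all add: negs_def)

lemma negs_pos_word [simp]: "negs (pos_word u) = 0"
  by (induction u) simp_all

text \<open>A signed word \<open>w\<close> is written as a left fraction \<open>\<Delta>\<^sup>-\<^sup>k m\<close>, where \<open>k = negs w\<close> and the positive word
\<open>m = numerator n w\<close> is computed by replacing the inverse of \<open>i\<close> with its complement in \<open>\<Delta>\<close>
followed by \<open>\<Delta>\<^sup>-\<^sup>1\<close> and by moving all these powers to the left, which flips what they pass.\<close>

fun numerator :: "nat \<Rightarrow> braid_word \<Rightarrow> nat list" where
  "numerator n [] = []"
| "numerator n ((e, i) # w) =
    flips n (negs w) (if e then [i] else flip n (letter_complement n i)) @ numerator n w"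

lemma numerator_append: "numerator n (u @ v) = flips n (negs v) (numerator n u) @ numerator n v"
proof (induction u)
  case (Cons x u)
  then show ?case by (cases x) (simp add: flips_append flips_add add.commute)
qed simp

lemma numerator_pos_word [simp]: "numerator n (pos_word u) = u"
  by (induction u) simp_all

lemma set_numerator: "w \<in> braid_words n \<Longrightarrow> set (numerator n w) \<subseteq> {1..<n}"
proof (induction w)
  case (Cons x w)
  obtain e i where x: "x = (e, i)" by force
  have "set (if e then [i] else flip n (letter_complement n i)) \<subseteq> {1..<n}"
    using Cons.prems x letter_complement(1)[of i n] set_flip by auto
  from set_flips[OF this] show ?case using Cons x by simp
qed simp

lemma fraction_cong_append:
  assumes eq: "delta_power n (negs v) @ numerator n u \<approx> delta_power n (negs u) @ numerator n v"
    and w: "u \<in> braid_words n" "v \<in> braid_words n" "a \<in> braid_words n" "b \<in> braid_words n"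
  shows "delta_power n (negs (a @ v @ b)) @ numerator n (a @ u @ b) \<approx>
    delta_power n (negs (a @ u @ b)) @ numerator n (a @ v @ b)"
proof -
  have move: "delta_power n (negs (a @ v' @ b)) @ numerator n (a @ u' @ b) \<approx>
      delta_power n (negs a + negs b) @ flips n (negs u' + negs v' + negs b) (numerator n a) @
        flips n (negs b) (delta_power n (negs v') @ numerator n u') @ numerator n b"
    if w': "u' \<in> braid_words n" "v' \<in> braid_words n" for u' v'
  proof -
    define A where "A = numerator n a"
    define U where "U = numerator n u'"
    define B where "B = numerator n b"
    have A: "set A \<subseteq> {1..<n}" using w by (simp add: A_def set_numerator)
    have "delta_power n (negs (a @ v' @ b)) @ numerator n (a @ u' @ b) =
        delta_power n (negs a + negs b) @ (delta_power n (negs v') @ flips n (negs u' + negs b) A) @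
          flips n (negs b) U @ B"
    proof -
      have "delta_power n (negs a + (negs v' + negs b)) =
          delta_power n (negs a + negs b) @ delta_power n (negs v')"
        by (simp add: ac_simps flip: delta_power_add)
      then show ?thesis
        by (simp add: numerator_append flips_append flips_add A_def U_def B_def ac_simps)
    qed
    also have "\<dots> \<approx> delta_power n (negs a + negs b) @
        (flips n (negs v') (flips n (negs u' + negs b) A) @ delta_power n (negs v')) @
          flips n (negs b) U @ B"
      using A by (intro peq_append_left peq_append_right delta_power_commute set_flips)
    also have "\<dots> = delta_power n (negs a + negs b) @ flips n (negs u' + negs v' + negs b) A @
        delta_power n (negs v') @ flips n (negs b) U @ B"
      by (simp add: flips_add ac_simps)
    also have "\<dots> \<approx> delta_power n (negs a + negs b) @ flips n (negs u' + negs v' + negs b) A @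
        flips n (negs b) (delta_power n (negs v')) @ flips n (negs b) U @ B"
      by (intro peq_append_left peq_append_right peq_sym[OF flips_delta_power])
    finally show ?thesis by (simp add: A_def U_def B_def flips_append)
  qed
  have "set (delta_power n (negs v) @ numerator n u) \<subseteq> {1..<n}"
    using w set_delta_power set_numerator by simp
  from flips_peq[OF eq this, of "negs b"]
  have "delta_power n (negs a + negs b) @ flips n (negs u + negs v + negs b) (numerator n a) @
        flips n (negs b) (delta_power n (negs v) @ numerator n u) @ numerator n b \<approx>
      delta_power n (negs a + negs b) @ flips n (negs u + negs v + negs b) (numerator n a) @
        flips n (negs b) (delta_power n (negs u) @ numerator n v) @ numerator n b"
    by (intro peq_append_left peq_append_right)
  note middle = this
  show ?thesis
    using peq_trans[OF move[OF w(1,2)] peq_trans[OF middle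
        peq_sym[OF move[OF w(2,1), unfolded add.commute[of "negs v" "negs u"]]]]] .
qed

text \<open>Equal braids have equal fractions, where equality of fractions means equality in the
monoid after clearing denominators. Left cancellation makes this relation transitive. For words
without negative letters the fraction is the word itself, hence the monoid embeds.\<close>

theorem fraction_cong:
  "braid_eq n u v \<Longrightarrow> delta_power n (negs v) @ numerator n u \<approx> delta_power n (negs u) @ numerator n v"
proof (induction rule: braid_eq.induct)
  case (sym u v)
  from sym.IH show ?case by (rule peq_sym)
next
  case (trans u v w)
  let ?D = "delta_power n"
  have "?D (negs v) @ ?D (negs w) @ numerator n u = ?D (negs w) @ ?D (negs v) @ numerator n u"
    by (simp add: add.commute flip: delta_power_add append_assoc)
  also have "\<dots> \<approx> ?D (negs w) @ ?D (negs u) @ numerator n v"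
    using trans.IH(1) by (rule peq_append_left)
  also have "\<dots> = ?D (negs u) @ ?D (negs w) @ numerator n v"
    by (simp add: add.commute flip: delta_power_add append_assoc)
  also have "\<dots> \<approx> ?D (negs u) @ ?D (negs v) @ numerator n w"
    using trans.IH(2) by (rule peq_append_left)
  also have "\<dots> = ?D (negs v) @ ?D (negs u) @ numerator n w"
    by (simp add: add.commute flip: delta_power_add append_assoc)
  finally show ?case by (rule peq_cancel_left)
next
  case (append u v a b)
  then show ?case using braid_eq_words[of n u v] by (intro fraction_cong_append) auto
next
  case (cancel i e)
  show ?case
  proof (cases e)
    case True
    have "i # letter_complement n i \<approx> delta_word n" by (rule letter_complement(2)[OF cancel])
    from flip_peq[OF this, of n] have "flip n (i # letter_complement n i) \<approx> flip n (delta_word n)"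
      using letter_complement(1)[OF cancel] cancel by auto
    then have "flip n (i # letter_complement n i) \<approx> delta_word n"
      using flip_delta_word peq_trans by blast
    then show ?thesis using True by (simp add: One_nat_def)
  next
    case False
    then show ?thesis using letter_complement_right[OF cancel] by (simp add: One_nat_def)
  qed
next
  case (far i j)
  then show ?case using peq_far[of i j "[]"] by simp
next
  case (braid i)
  have "[i, i + 1, i] \<approx> [i + 1, i, i + 1]" by (rule peq_braid) simp
  then show ?case by simp
qed simp

lemma peq_if_braid_eq: "braid_eq n (pos_word u) (pos_word v) \<Longrightarrow> u \<approx> v"
  using fraction_cong[of n "pos_word u" "pos_word v"] by simp

lemma braid_eq_if_pstep: "pstep u v \<Longrightarrow> set u \<subseteq> {1..<n} \<Longrightarrow> braid_eq n (pos_word u) (pos_word v)"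
proof (induction rule: pstep.induct)
  case (far i j u)
  have "braid_eq n [(True, i), (True, j)] [(True, j), (True, i)]"
    using far braid_eq.far[of i n j] braid_eq.sym[OF braid_eq.far[of j n i]] by auto
  from braid_eq_append[OF this braid_eq.refl[of "pos_word u"]] show ?case using far by simp
next
  case (braid i j u)
  have "braid_eq n [(True, i), (True, j), (True, i)] [(True, j), (True, i), (True, j)]"
    using braid braid_eq.braid[of i n] braid_eq.sym[OF braid_eq.braid[of j n]] by auto
  from braid_eq_append[OF this braid_eq.refl[of "pos_word u"]] show ?case using braid by simp
next
  case (Cons u v i)
  have "braid_eq n [(True, i)] [(True, i)]" using Cons.prems by (intro braid_eq.refl) simp
  from braid_eq_append[OF this] show ?case using Cons by simp
qed

lemma braid_eq_if_peq: "u \<approx> v \<Longrightarrow> set u \<subseteq> {1..<n} \<Longrightarrow> braid_eq n (pos_word u) (pos_word v)"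
  unfolding peq_def
proof (induction rule: rtranclp_induct)
  case base
  then show ?case by (intro braid_eq.refl) simp
next
  case (step v w)
  have "set v \<subseteq> {1..<n}" using step.hyps(1) step.prems peq_set[of u v] by (simp add: peq_def)
  then have "braid_eq n (pos_word v) (pos_word w)" using step.hyps(2) by (intro braid_eq_if_pstep)
  then show ?case by (rule braid_eq.trans[OF step.IH[OF step.prems]])
qed

section \<open>Positive braids\<close>

definition exponent_sum :: "braid_word \<Rightarrow> int" where
  "exponent_sum w = (\<Sum>x\<leftarrow>w. if fst x then 1 else - 1)"

lemma exponent_sum_simps [simp]:
  "exponent_sum [] = 0" "exponent_sum ((e, i) # w) = (if e then 1 else - 1) + exponent_sum w"
  "exponent_sum (u @ v) = exponent_sum u + exponent_sum v"
  by (simp_all add: exponent_sum_def)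

lemma exponent_sum_pos_word [simp]: "exponent_sum (pos_word u) = int (length u)"
  by (induction u) simp_all

lemma braid_eq_exponent_sum: "braid_eq n u v \<Longrightarrow> exponent_sum u = exponent_sum v"
  by (induction rule: braid_eq.induct) auto

definition braid_len :: "braid \<Rightarrow> int" where
  "braid_len g = exponent_sum (SOME w. w \<in> g)"

lemma braid_len_class:
  assumes "w \<in> braid_words n"
  shows "braid_len (braid_class n w) = exponent_sum w"
proof -
  have "w \<in> braid_class n w" using assms by (auto simp: braid_class_def intro: braid_eq.refl)
  then have "(SOME v. v \<in> braid_class n w) \<in> braid_class n w" by (rule someI)
  then show ?thesis
    using braid_eq_exponent_sum by (auto simp: braid_class_def braid_len_def)
qed

definition pos_class :: "nat \<Rightarrow> nat list \<Rightarrow> braid" where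
  "pos_class n u = braid_class n (pos_word u)"

lemma pos_class_carrier [simp]: "set u \<subseteq> {1..<n} \<Longrightarrow> pos_class n u \<in> carrier (braid_group n)"
  by (simp add: pos_class_def)

lemma pos_class_eq_iff:
  assumes "set u \<subseteq> {1..<n}"
  shows "pos_class n u = pos_class n v \<longleftrightarrow> u \<approx> v"
  using assms peq_if_braid_eq braid_eq_if_peq by (auto simp: pos_class_def braid_class_eq_iff)

lemma pos_class_append:
  "set u \<subseteq> {1..<n} \<Longrightarrow> set v \<subseteq> {1..<n} \<Longrightarrow>
    pos_class n u \<otimes>\<^bsub>braid_group n\<^esub> pos_class n v = pos_class n (u @ v)"
  by (simp add: pos_class_def braid_class_mult)

lemma pos_class_Nil: "pos_class n [] = \<one>\<^bsub>braid_group n\<^esub>"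
  by (simp add: pos_class_def braid_group_def)

lemma pos_class_letter: "pos_class n [i] = sigma n i"
  by (simp add: pos_class_def sigma_def)

lemma pos_class_positive: "set u \<subseteq> {1..<n} \<Longrightarrow> pos_class n u \<in> positive_braids n"
proof (induction u)
  case Nil
  then show ?case by (simp add: pos_class_Nil positive_braids.one)
next
  case (Cons i u)
  have "pos_class n (i # u) = sigma n i \<otimes>\<^bsub>braid_group n\<^esub> pos_class n u"
    using Cons.prems pos_class_append[of "[i]" n u] by (simp add: pos_class_letter)
  then show ?case using Cons by (simp add: positive_braids.mult positive_braids.gen)
qed

lemma positive_braid_pos_class:
  "a \<in> positive_braids n \<Longrightarrow> \<exists>u. set u \<subseteq> {1..<n} \<and> a = pos_class n u"
proof (induction rule: positive_braids.induct)
  case one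
  then show ?case by (intro exI[of _ "[]"]) (simp add: pos_class_Nil)
next
  case (gen i)
  then show ?case by (intro exI[of _ "[i]"]) (simp add: pos_class_letter)
next
  case (mult a b)
  then obtain u v where "set u \<subseteq> {1..<n}" "a = pos_class n u" "set v \<subseteq> {1..<n}" "b = pos_class n v"
    by blast
  then show ?case by (intro exI[of _ "u @ v"]) (simp add: pos_class_append)
qed

lemma positive_braids_eq: "positive_braids n = pos_class n ` {u. set u \<subseteq> {1..<n}}"
  using positive_braid_pos_class pos_class_positive by blast

lemma braid_len_pos_class: "set u \<subseteq> {1..<n} \<Longrightarrow> braid_len (pos_class n u) = int (length u)"
  by (simp add: pos_class_def braid_len_class)

lemma braid_prod_sigma:
  "set u \<subseteq> {1..<n} \<Longrightarrow> braid_prod n (map (sigma n) u) = pos_class n u"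
proof (induction u)
  case (Cons i u)
  then show ?case
    using pos_class_append[of "[i]" n u] by (simp add: braid_prod_def pos_class_letter)
qed (simp add: braid_prod_def pos_class_Nil)

lemma Delta_eq: "Delta n = pos_class n (delta_word n)"
  using braid_prod_sigma[OF set_delta_word]
  by (simp add: Delta_def delta_word_def down_def[abs_def])

lemma positive_cone_braid: "positive_cone (braid_group n) (positive_braids n) braid_len"
proof (intro positive_cone.intro group_braid_group positive_cone_axioms.intro)
  show "positive_braids n \<subseteq> carrier (braid_group n)" by (auto simp: positive_braids_eq)
  show "\<one>\<^bsub>braid_group n\<^esub> \<in> positive_braids n" by (rule positive_braids.one)
  show "a \<otimes>\<^bsub>braid_group n\<^esub> b \<in> positive_braids n" if "a \<in> positive_braids n" "b \<in> positive_braids n" for a b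
    using that by (rule positive_braids.mult)
  show "braid_len (x \<otimes>\<^bsub>braid_group n\<^esub> y) = braid_len x + braid_len y"
    if "x \<in> carrier (braid_group n)" "y \<in> carrier (braid_group n)" for x y
  proof -
    obtain u v where "u \<in> braid_words n" "x = braid_class n u" "v \<in> braid_words n" "y = braid_class n v"
      using \<open>x \<in> _\<close> \<open>y \<in> _\<close> by (auto simp: braid_group_def)
    then show ?thesis by (simp add: braid_class_mult braid_len_class)
  qed
  show "0 \<le> braid_len a" if "a \<in> positive_braids n" for a
    using that by (auto simp: positive_braids_eq braid_len_pos_class)
  show "a = \<one>\<^bsub>braid_group n\<^esub>" if "a \<in> positive_braids n" "braid_len a = 0" for a
    using that by (auto simp: positive_braids_eq braid_len_pos_class pos_class_Nil)
qed

section \<open>The braid group is a Garside group\<close>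

text \<open>The number of strands is fixed here, so that the abstract theory can be instantiated with
short names.\<close>

locale braids =
  fixes n :: nat
begin

sublocale positive_cone "braid_group n" "positive_braids n" braid_len
  by (rule positive_cone_braid)

notation le (infix "\<preceq>" 50)

abbreviation B where "B \<equiv> braid_group n"
abbreviation P where "P \<equiv> positive_braids n"

lemma pos_casesE:
  assumes "a \<in> P"
  obtains "a = \<one>\<^bsub>B\<^esub>" | i b where "i \<in> {1..<n}" "b \<in> P" "a = sigma n i \<otimes>\<^bsub>B\<^esub> b"
proof -
  obtain u where u: "set u \<subseteq> {1..<n}" "a = pos_class n u"
    using assms positive_braid_pos_class by blast
  show thesis
  proof (cases u)
    case Nil
    then show ?thesis using u that(1) by (simp add: pos_class_Nil)
  next
    case (Cons i v)
    then show ?thesis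
      using u pos_class_append[of "[i]" n v] pos_class_positive[of v n]
      by (intro that(2)[of i "pos_class n v"]) (simp_all add: pos_class_letter)
  qed
qed

lemma sigma_pos: "i \<in> {1..<n} \<Longrightarrow> sigma n i \<in> P"
  by (rule positive_braids.gen)

definition lcm_sigma :: "nat \<Rightarrow> nat \<Rightarrow> braid" where
  "lcm_sigma i j = pos_class n (i # complement i j)"

lemma lcm_sigma_sym: "i \<in> {1..<n} \<Longrightarrow> j \<in> {1..<n} \<Longrightarrow> lcm_sigma i j = lcm_sigma j i"
  unfolding lcm_sigma_def using complement_lcm[of i j "[]"]
  by (subst pos_class_eq_iff) (auto simp: complement_def)

text \<open>By the embedding, an equation between positive braids lifts to positive words, where Garside's lemma
applies.\<close>

lemma lcm_sigma_least:
  assumes i: "i \<in> {1..<n}" and j: "j \<in> {1..<n}" and "sigma n i \<preceq> z" "sigma n j \<preceq> z"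
    and z: "z \<in> carrier B"
  shows "lcm_sigma i j \<preceq> z"
proof -
  obtain u where u: "set u \<subseteq> {1..<n}" "inv\<^bsub>B\<^esub> sigma n i \<otimes>\<^bsub>B\<^esub> z = pos_class n u"
    using assms(3) positive_braid_pos_class by blast
  obtain v where v: "set v \<subseteq> {1..<n}" "inv\<^bsub>B\<^esub> sigma n j \<otimes>\<^bsub>B\<^esub> z = pos_class n v"
    using assms(4) positive_braid_pos_class by blast
  have "z = sigma n i \<otimes>\<^bsub>B\<^esub> pos_class n u" "z = sigma n j \<otimes>\<^bsub>B\<^esub> pos_class n v"
    using u(2)[symmetric] v(2)[symmetric] z i j by (simp_all add: sigma_in_carrier)
  then have zu: "z = pos_class n (i # u)" and zv: "z = pos_class n (j # v)"
    using u(1) v(1) i j pos_class_append[of "[i]" n u] pos_class_append[of "[j]" n v]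
    by (simp_all add: pos_class_letter)
  then have "i # u \<approx> j # v"
    using u(1) i pos_class_eq_iff[of "i # u" n "j # v"] by simp
  from garside_key[OF this] obtain w where w: "u \<approx> complement i j @ w"
    unfolding completes_def by blast
  have sw: "set (complement i j) \<subseteq> {1..<n}" "set w \<subseteq> {1..<n}"
    using peq_set[OF w] u(1) by auto
  have "z = pos_class n ((i # complement i j) @ w)"
    using zu w u(1) i pos_class_eq_iff[of "i # u" n] peq_Cons[OF w, of i] by simp
  also have "\<dots> = lcm_sigma i j \<otimes>\<^bsub>B\<^esub> pos_class n w"
    unfolding lcm_sigma_def using sw i by (subst pos_class_append) simp_all
  finally have zL: "z = lcm_sigma i j \<otimes>\<^bsub>B\<^esub> pos_class n w" .
  have "lcm_sigma i j \<in> carrier B" unfolding lcm_sigma_def using sw i by (intro pos_class_carrier) simp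
  then show ?thesis using zL sw pos_class_positive[OF sw(2)] by simp
qed

text \<open>Induction on the length of the common multiple \<open>z\<close>. If \<open>a\<close> and \<open>b\<close> begin with the
generators \<open>i\<close> and \<open>j\<close>, whose least common multiple is \<open>L\<close>, then every common
multiple of \<open>a\<close> and \<open>b\<close> is a multiple of \<open>L\<close>. Hence the join of \<open>a\<close> and \<open>b\<close> is the join of \<open>e\<close>, the
join of \<open>a\<close> and \<open>L\<close>, with \<open>f\<close>, the join of \<open>b\<close> and \<open>L\<close>. In each of these three joins
a common prefix (the generator \<open>i\<close>, the generator \<open>j\<close>, or \<open>L\<close>) can be removed, which
shortens \<open>z\<close>.\<close>

lemma lub_ex_positive:
  assumes "a \<in> P" "b \<in> P" "z \<in> carrier B" "a \<preceq> z" "b \<preceq> z"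
  shows "\<exists>d. is_lub d a b"
  using assms
proof (induction "nat (braid_len z)" arbitrary: a b z rule: less_induct)
  case less
  have comm: "is_lub d a b \<Longrightarrow> is_lub d b a" for d a b by (auto simp: is_lub_def)
  have triv: "is_lub b \<one>\<^bsub>B\<^esub> b" if "b \<in> P" for b using that pos_one by (auto simp: is_lub_def)
  show ?case
  proof (cases "a = \<one>\<^bsub>B\<^esub> \<or> b = \<one>\<^bsub>B\<^esub>")
    case True
    then show ?thesis using triv comm less.prems by blast
  next
    case False
    obtain i a' where i: "i \<in> {1..<n}" and a': "a' \<in> P" and a: "a = sigma n i \<otimes>\<^bsub>B\<^esub> a'"
      using pos_casesE[OF less.prems(1)] False by blast
    obtain j b' where j: "j \<in> {1..<n}" and b': "b' \<in> P" and b: "b = sigma n j \<otimes>\<^bsub>B\<^esub> b'"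
      using pos_casesE[OF less.prems(2)] False by blast
    define L where "L = lcm_sigma i j"
    have shorter: "\<exists>d. is_lub d (c \<otimes>\<^bsub>B\<^esub> p) (c \<otimes>\<^bsub>B\<^esub> q)"
      if pq: "p \<in> P" "q \<in> P" "c \<in> P" "c \<noteq> \<one>\<^bsub>B\<^esub>" "c \<otimes>\<^bsub>B\<^esub> p \<preceq> z" "c \<otimes>\<^bsub>B\<^esub> q \<preceq> z" for p q c
    proof -
      have zc: "z = c \<otimes>\<^bsub>B\<^esub> (inv\<^bsub>B\<^esub> c \<otimes>\<^bsub>B\<^esub> z)" using pq less.prems by simp
      have le: "p \<preceq> inv\<^bsub>B\<^esub> c \<otimes>\<^bsub>B\<^esub> z" "q \<preceq> inv\<^bsub>B\<^esub> c \<otimes>\<^bsub>B\<^esub> z"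
        using pq less.prems(3) le_translate[of p "inv\<^bsub>B\<^esub> c \<otimes>\<^bsub>B\<^esub> z" c]
          le_translate[of q "inv\<^bsub>B\<^esub> c \<otimes>\<^bsub>B\<^esub> z" c] by simp_all
      have "braid_len c > 0" using pq len_nonneg[of c] len_eq_0[of c] by force
      moreover have "braid_len p \<ge> 0" using pq len_nonneg by blast
      moreover have "braid_len (c \<otimes>\<^bsub>B\<^esub> p) \<le> braid_len z"
        using len_nonneg[OF pq(5)] pq less.prems(3) by (simp add: len_mult)
      ultimately have "nat (braid_len (inv\<^bsub>B\<^esub> c \<otimes>\<^bsub>B\<^esub> z)) < nat (braid_len z)"
        using pq less.prems(3) by (simp add: len_mult)
      then obtain d where "is_lub d p q"
        using less.hyps[of "inv\<^bsub>B\<^esub> c \<otimes>\<^bsub>B\<^esub> z" p q] le pq less.prems(3) by auto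
      then have "is_lub (c \<otimes>\<^bsub>B\<^esub> d) (c \<otimes>\<^bsub>B\<^esub> p) (c \<otimes>\<^bsub>B\<^esub> q)"
        using pq by (subst is_lub_translate) (auto simp: is_lub_def)
      then show ?thesis by blast
    qed
    have sub: "set (complement i j) \<subseteq> {1..<n}" "set (complement j i) \<subseteq> {1..<n}"
      using i j by (auto simp: complement_def)
    have Li: "L = sigma n i \<otimes>\<^bsub>B\<^esub> pos_class n (complement i j)"
      using pos_class_append[of "[i]" n "complement i j"] sub i
      by (simp add: L_def lcm_sigma_def pos_class_letter)
    have "L = lcm_sigma j i" unfolding L_def using i j by (rule lcm_sigma_sym)
    then have Lj: "L = sigma n j \<otimes>\<^bsub>B\<^esub> pos_class n (complement j i)"
      using pos_class_append[of "[j]" n "complement j i"] sub j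
      by (simp add: lcm_sigma_def pos_class_letter)
    have sc [simp]: "sigma n i \<in> carrier B" "sigma n j \<in> carrier B"
      using i j sigma_in_carrier by blast+
    have Lc [simp]: "L \<in> carrier B" using Li sub by simp
    have LP: "L \<in> P" unfolding L_def lcm_sigma_def using sub i by (intro pos_class_positive) simp
    have len_sigma: "braid_len (sigma n k) = 1" if "k \<in> {1..<n}" for k
      using braid_len_pos_class[of "[k]" n] that by (simp add: pos_class_letter)
    have ne: "sigma n i \<noteq> \<one>\<^bsub>B\<^esub>" "sigma n j \<noteq> \<one>\<^bsub>B\<^esub>" "L \<noteq> \<one>\<^bsub>B\<^esub>"
    proof -
      have "braid_len L > 0"
        unfolding L_def lcm_sigma_def using sub i by (subst braid_len_pos_class) simp_all
      then show "L \<noteq> \<one>\<^bsub>B\<^esub>" by auto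
    qed (use len_sigma[OF i] len_sigma[OF j] in auto)
    have sa: "sigma n i \<preceq> a" and sb: "sigma n j \<preceq> b" using a b a' b' by simp_all
    have L_le: "L \<preceq> y" if "a \<preceq> y" "b \<preceq> y" "y \<in> carrier B" for y
    proof -
      have "sigma n i \<preceq> y" by (rule le_trans[OF sa that(1)]) (use that less.prems in simp_all)
      moreover have "sigma n j \<preceq> y" by (rule le_trans[OF sb that(2)]) (use that less.prems in simp_all)
      ultimately show ?thesis unfolding L_def using i j that(3) by (intro lcm_sigma_least)
    qed
    have Lz: "L \<preceq> z" using L_le less.prems by blast
    obtain e where e: "is_lub e a L"
      using shorter[OF a' pos_class_positive[OF sub(1)] sigma_pos[OF i] ne(1)] less.prems(4) Lz
      unfolding a[symmetric] Li[symmetric] by blast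
    obtain f where f: "is_lub f b L"
      using shorter[OF b' pos_class_positive[OF sub(2)] sigma_pos[OF j] ne(2)] less.prems(5) Lz
      unfolding b[symmetric] Lj[symmetric] by blast
    have ec: "e \<in> carrier B" "a \<preceq> e" "L \<preceq> e" and fc: "f \<in> carrier B" "b \<preceq> f" "L \<preceq> f"
      using e f by (simp_all add: is_lub_def)
    have e_le: "e \<preceq> y" if "a \<preceq> y" "L \<preceq> y" "y \<in> carrier B" for y
      using e that unfolding is_lub_def by blast
    have f_le: "f \<preceq> y" if "b \<preceq> y" "L \<preceq> y" "y \<in> carrier B" for y
      using f that unfolding is_lub_def by blast
    have ez: "e \<preceq> z" using e_le less.prems Lz by blast
    have fz: "f \<preceq> z" using f_le less.prems Lz by blast
    have cancel: "L \<otimes>\<^bsub>B\<^esub> (inv\<^bsub>B\<^esub> L \<otimes>\<^bsub>B\<^esub> e) = e" "L \<otimes>\<^bsub>B\<^esub> (inv\<^bsub>B\<^esub> L \<otimes>\<^bsub>B\<^esub> f) = f"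
      using ec fc by simp_all
    obtain d where d: "is_lub d e f"
      using shorter[OF ec(3) fc(3) LP ne(3)] ez fz unfolding cancel by blast
    have dc: "d \<in> carrier B" "e \<preceq> d" "f \<preceq> d" using d by (simp_all add: is_lub_def)
    have d_le: "d \<preceq> y" if "e \<preceq> y" "f \<preceq> y" "y \<in> carrier B" for y
      using d that unfolding is_lub_def by blast
    have "a \<preceq> d" by (rule le_trans[OF ec(2) dc(2)]) (use less.prems ec dc in simp_all)
    moreover have "b \<preceq> d" by (rule le_trans[OF fc(2) dc(3)]) (use less.prems fc dc in simp_all)
    moreover have "d \<preceq> y" if "y \<in> carrier B" "a \<preceq> y" "b \<preceq> y" for y
      using that L_le e_le f_le d_le by blast
    ultimately have "is_lub d a b" using dc(1) unfolding is_lub_def by blast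
    then show ?thesis by blast
  qed
qed

abbreviation \<Delta> where "\<Delta> \<equiv> Delta n"

lemma Delta_pos: "\<Delta> \<in> P"
  unfolding Delta_eq by (intro pos_class_positive set_delta_word)

lemma Delta_carrier [simp]: "\<Delta> \<in> carrier B"
  using Delta_pos by simp

lemma Delta_conj:
  assumes "a \<in> P"
  shows "inv\<^bsub>B\<^esub> \<Delta> \<otimes>\<^bsub>B\<^esub> a \<otimes>\<^bsub>B\<^esub> \<Delta> \<in> P" "\<Delta> \<otimes>\<^bsub>B\<^esub> a \<otimes>\<^bsub>B\<^esub> inv\<^bsub>B\<^esub> \<Delta> \<in> P"
proof -
  obtain u where u: "set u \<subseteq> {1..<n}" "a = pos_class n u"
    using assms positive_braid_pos_class by blast
  have slide: "pos_class n v \<otimes>\<^bsub>B\<^esub> \<Delta> = \<Delta> \<otimes>\<^bsub>B\<^esub> pos_class n (flip n v)" if "set v \<subseteq> {1..<n}" for v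
    unfolding Delta_eq using that set_flip[OF that] set_delta_word delta_word_commute[OF that]
    by (simp add: pos_class_append pos_class_eq_iff peq_sym)
  define f where "f = pos_class n (flip n u)"
  have fP: "f \<in> P" unfolding f_def using u by (intro pos_class_positive set_flip)
  have "a \<otimes>\<^bsub>B\<^esub> \<Delta> = \<Delta> \<otimes>\<^bsub>B\<^esub> f" using slide[OF u(1)] by (simp add: u f_def)
  then show "inv\<^bsub>B\<^esub> \<Delta> \<otimes>\<^bsub>B\<^esub> a \<otimes>\<^bsub>B\<^esub> \<Delta> \<in> P" using fP assms by (simp add: m_assoc)
  have "f \<otimes>\<^bsub>B\<^esub> \<Delta> = \<Delta> \<otimes>\<^bsub>B\<^esub> a"
    using slide[OF set_flip[OF u(1)]] u by (simp add: f_def flip_flip)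
  then show "\<Delta> \<otimes>\<^bsub>B\<^esub> a \<otimes>\<^bsub>B\<^esub> inv\<^bsub>B\<^esub> \<Delta> \<in> P" using fP assms by (simp flip: \<open>f \<otimes>\<^bsub>B\<^esub> \<Delta> = \<Delta> \<otimes>\<^bsub>B\<^esub> a\<close>)
qed

lemma sigma_le_Delta: "i \<in> {1..<n} \<Longrightarrow> sigma n i \<preceq> \<Delta>"
proof -
  assume i: "i \<in> {1..<n}"
  note s = letter_complement[OF i]
  have "\<Delta> = sigma n i \<otimes>\<^bsub>B\<^esub> pos_class n (letter_complement n i)"
    using s i pos_class_append[of "[i]" n "letter_complement n i"] set_delta_word[of n]
    by (simp add: Delta_eq pos_class_letter pos_class_eq_iff peq_sym)
  then show ?thesis using s(1) i sigma_in_carrier pos_class_positive by simp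
qed

lemma sigma_right_divides_Delta: "i \<in> {1..<n} \<Longrightarrow> \<Delta> \<otimes>\<^bsub>B\<^esub> inv\<^bsub>B\<^esub> sigma n i \<in> P"
proof -
  assume i: "i \<in> {1..<n}"
  let ?s = "flip n (letter_complement n i)"
  have s: "set ?s \<subseteq> {1..<n}" using letter_complement(1)[OF i] by (rule set_flip)
  have "\<Delta> = pos_class n ?s \<otimes>\<^bsub>B\<^esub> sigma n i"
    using s i pos_class_append[of ?s n "[i]"] set_delta_word[of n] letter_complement_right[OF i]
    by (simp add: Delta_eq pos_class_letter[symmetric] pos_class_eq_iff peq_sym)
  then show ?thesis using s i sigma_in_carrier[OF i] pos_class_positive[OF s] by simp
qed

lemma braid_class_inverse_letter:
  assumes i: "i \<in> {1..<n}"
  shows "braid_class n [(False, i)] = inv\<^bsub>B\<^esub> sigma n i"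
proof -
  have "braid_class n [(False, i), (True, i)] = braid_class n []"
    using braid_eq.cancel[OF i, of False] i by (simp add: braid_class_eq_iff)
  then have "braid_class n [(False, i)] \<otimes>\<^bsub>B\<^esub> sigma n i = \<one>\<^bsub>B\<^esub>"
    using i pos_class_Nil[of n] by (simp add: sigma_def braid_class_mult pos_class_def)
  then show ?thesis using i sigma_in_carrier[OF i] by (intro inv_equality[symmetric]) simp_all
qed

text \<open>Every braid is a fraction: multiplying on the right by the inverse of a generator costs one more
\<open>\<Delta>\<close>, which is then moved to the left by conjugation.\<close>

lemma Delta_pow_mult_positive:
  assumes "g \<in> carrier B"
  shows "\<exists>k::nat. \<Delta> [^]\<^bsub>B\<^esub> k \<otimes>\<^bsub>B\<^esub> g \<in> P"
proof -
  obtain w where w: "w \<in> braid_words n" "g = braid_class n w"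
    using assms by (auto simp: braid_group_def)
  have "\<exists>k::nat. \<Delta> [^]\<^bsub>B\<^esub> k \<otimes>\<^bsub>B\<^esub> braid_class n w \<in> P"
    using w(1)
  proof (induction w rule: rev_induct)
    case Nil
    have "\<Delta> [^]\<^bsub>B\<^esub> (0::nat) \<otimes>\<^bsub>B\<^esub> braid_class n [] \<in> P"
      using pos_one pos_class_Nil[of n] by (simp add: pos_class_def)
    then show ?case by blast
  next
    case (snoc x w)
    obtain e i where x: "x = (e, i)" by force
    have w: "w \<in> braid_words n" and i: "i \<in> {1..<n}" using snoc.prems x by auto
    obtain k :: nat where k: "\<Delta> [^]\<^bsub>B\<^esub> k \<otimes>\<^bsub>B\<^esub> braid_class n w \<in> P" using snoc.IH w by blast
    have split: "braid_class n (w @ [x]) = braid_class n w \<otimes>\<^bsub>B\<^esub> braid_class n [x]"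
      using w i by (simp add: braid_class_mult x)
    have sc: "sigma n i \<in> carrier B" using i by (rule sigma_in_carrier)
    show ?case
    proof (cases e)
      case True
      have "\<Delta> [^]\<^bsub>B\<^esub> k \<otimes>\<^bsub>B\<^esub> braid_class n w \<otimes>\<^bsub>B\<^esub> sigma n i \<in> P"
        using k sigma_pos[OF i] by (rule pos_mult)
      then have "\<Delta> [^]\<^bsub>B\<^esub> k \<otimes>\<^bsub>B\<^esub> braid_class n (w @ [x]) \<in> P"
        unfolding split using True w i by (simp add: x sigma_def m_assoc)
      then show ?thesis by blast
    next
      case False
      have inv: "braid_class n [x] = inv\<^bsub>B\<^esub> sigma n i"
        using braid_class_inverse_letter[OF i] False by (simp add: x)
      have "\<Delta> [^]\<^bsub>B\<^esub> k \<otimes>\<^bsub>B\<^esub> braid_class n w \<otimes>\<^bsub>B\<^esub> (inv\<^bsub>B\<^esub> sigma n i \<otimes>\<^bsub>B\<^esub> \<Delta>) \<in> P"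
        using k sigma_le_Delta[OF i] by (rule pos_mult)
      from Delta_conj(2)[OF this]
      have "\<Delta> \<otimes>\<^bsub>B\<^esub> \<Delta> [^]\<^bsub>B\<^esub> k \<otimes>\<^bsub>B\<^esub> (braid_class n w \<otimes>\<^bsub>B\<^esub> inv\<^bsub>B\<^esub> sigma n i) \<in> P"
        using w sc by (simp add: m_assoc)
      then have "\<Delta> [^]\<^bsub>B\<^esub> Suc k \<otimes>\<^bsub>B\<^esub> braid_class n (w @ [x]) \<in> P"
        unfolding split inv using nat_pow_Suc2[OF Delta_carrier] by simp
      then show ?thesis by blast
    qed
  qed
  then show ?thesis by (simp add: w)
qed

lemma Delta_pow_mult_positive2:
  assumes "a \<in> carrier B" "b \<in> carrier B"
  shows "\<exists>c\<in>carrier B. (\<exists>k::nat. c = \<Delta> [^]\<^bsub>B\<^esub> k) \<and> c \<otimes>\<^bsub>B\<^esub> a \<in> P \<and> c \<otimes>\<^bsub>B\<^esub> b \<in> P"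
proof -
  obtain k l :: nat where k: "\<Delta> [^]\<^bsub>B\<^esub> k \<otimes>\<^bsub>B\<^esub> a \<in> P" and l: "\<Delta> [^]\<^bsub>B\<^esub> l \<otimes>\<^bsub>B\<^esub> b \<in> P"
    using assms Delta_pow_mult_positive by meson
  have pow: "\<Delta> [^]\<^bsub>B\<^esub> m \<in> P" for m :: nat
    by (induction m) (simp_all add: pos_one pos_mult Delta_pos)
  have "\<Delta> [^]\<^bsub>B\<^esub> (l + k) \<otimes>\<^bsub>B\<^esub> a \<in> P" "\<Delta> [^]\<^bsub>B\<^esub> (k + l) \<otimes>\<^bsub>B\<^esub> b \<in> P"
    using pos_mult[OF pow[of l] k] pos_mult[OF pow[of k] l] assms
    by (simp_all add: nat_pow_mult[symmetric] m_assoc)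
  then show ?thesis
    by (intro bexI[of _ "\<Delta> [^]\<^bsub>B\<^esub> (k + l)"]) (auto simp: add.commute)
qed

lemma Delta_pow_conj: "a \<in> P \<Longrightarrow> inv\<^bsub>B\<^esub> (\<Delta> [^]\<^bsub>B\<^esub> (k::nat)) \<otimes>\<^bsub>B\<^esub> a \<otimes>\<^bsub>B\<^esub> \<Delta> [^]\<^bsub>B\<^esub> k \<in> P"
proof (induction k)
  case (Suc k)
  from Delta_conj(1)[OF Suc.IH[OF Suc.prems]] show ?case
    using Suc.prems by (simp add: inv_mult_group m_assoc)
qed simp

text \<open>A large power of \<open>\<Delta>\<close> moves \<open>a\<close> and \<open>b\<close> into the positive monoid, and another one is
a common multiple there.\<close>

lemma braid_lub_ex:
  assumes a: "a \<in> carrier B" and b: "b \<in> carrier B"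
  shows "\<exists>d. is_lub d a b"
proof -
  obtain c where c: "c \<in> carrier B" "c \<otimes>\<^bsub>B\<^esub> a \<in> P" "c \<otimes>\<^bsub>B\<^esub> b \<in> P"
    using Delta_pow_mult_positive2[OF a b] by blast
  obtain k :: nat where k: "\<Delta> [^]\<^bsub>B\<^esub> k \<otimes>\<^bsub>B\<^esub> inv\<^bsub>B\<^esub> (c \<otimes>\<^bsub>B\<^esub> a) \<in> P"
    "\<Delta> [^]\<^bsub>B\<^esub> k \<otimes>\<^bsub>B\<^esub> inv\<^bsub>B\<^esub> (c \<otimes>\<^bsub>B\<^esub> b) \<in> P"
    using Delta_pow_mult_positive2[of "inv\<^bsub>B\<^esub> (c \<otimes>\<^bsub>B\<^esub> a)" "inv\<^bsub>B\<^esub> (c \<otimes>\<^bsub>B\<^esub> b)"] a b c(1) by auto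
  have "c \<otimes>\<^bsub>B\<^esub> a \<preceq> \<Delta> [^]\<^bsub>B\<^esub> k" "c \<otimes>\<^bsub>B\<^esub> b \<preceq> \<Delta> [^]\<^bsub>B\<^esub> k"
    using Delta_pow_conj[OF k(1), of k] Delta_pow_conj[OF k(2), of k] a b c(1) by (simp_all add: m_assoc)
  from lub_ex_positive[OF c(2,3) _ this]
  obtain d where d: "is_lub d (c \<otimes>\<^bsub>B\<^esub> a) (c \<otimes>\<^bsub>B\<^esub> b)"
    using nat_pow_closed[OF Delta_carrier] by blast
  then have dc: "d \<in> carrier B" by (simp add: is_lub_def)
  then have "is_lub (c \<otimes>\<^bsub>B\<^esub> (inv\<^bsub>B\<^esub> c \<otimes>\<^bsub>B\<^esub> d)) (c \<otimes>\<^bsub>B\<^esub> a) (c \<otimes>\<^bsub>B\<^esub> b)" using c(1) d by simp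
  then have "is_lub (inv\<^bsub>B\<^esub> c \<otimes>\<^bsub>B\<^esub> d) a b" using a b c(1) dc by (subst (asm) is_lub_translate) simp_all
  then show ?thesis by blast
qed

lemma braid_glb_ex:
  assumes a: "a \<in> carrier B" and b: "b \<in> carrier B"
  shows "\<exists>d. is_glb d a b"
proof -
  obtain c where c: "c \<in> carrier B" "c \<otimes>\<^bsub>B\<^esub> a \<in> P" "c \<otimes>\<^bsub>B\<^esub> b \<in> P"
    using Delta_pow_mult_positive2[OF a b] by blast
  show ?thesis
    by (rule glb_ex_if_lub_ex[OF braid_lub_ex a b, of "inv\<^bsub>B\<^esub> c"]) (use c in simp_all)
qed

lemma pos_last_casesE:
  assumes "a \<in> P"
  obtains "a = \<one>\<^bsub>B\<^esub>" | i b where "i \<in> {1..<n}" "b \<in> P" "a = b \<otimes>\<^bsub>B\<^esub> sigma n i"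
proof -
  obtain u where u: "set u \<subseteq> {1..<n}" "a = pos_class n u"
    using assms positive_braid_pos_class by blast
  show thesis
  proof (cases u rule: rev_cases)
    case Nil
    then show ?thesis using u that(1) by (simp add: pos_class_Nil)
  next
    case (snoc v i)
    then show ?thesis
      using u pos_class_append[of v n "[i]"] pos_class_positive[of v n]
      by (intro that(2)[of i "pos_class n v"]) (simp_all add: pos_class_letter)
  qed
qed

lemma sigma_ne_one: "i \<in> {1..<n} \<Longrightarrow> sigma n i \<noteq> \<one>\<^bsub>B\<^esub>"
  using pos_class_eq_iff[of "[i]" n "[]"] peq_length[of "[i]" "[]"]
  by (auto simp: pos_class_letter pos_class_Nil)

sublocale garside_group "braid_group n" "positive_braids n" braid_len "Delta n"
proof
  show "\<Delta> \<in> P" by (rule Delta_pos)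
  show "finite {a \<in> P. braid_len a = m}" for m
  proof (rule finite_subset)
    show "{a \<in> P. braid_len a = m} \<subseteq> pos_class n ` {u. set u \<subseteq> {1..<n} \<and> length u = nat m}"
      by (auto simp: positive_braids_eq braid_len_pos_class)
    show "finite (pos_class n ` {u. set u \<subseteq> {1..<n} \<and> length u = nat m})"
      by (intro finite_imageI finite_lists_length_eq) simp
  qed
  fix a assume a: "a \<in> P"
  show "inv\<^bsub>B\<^esub> \<Delta> \<otimes>\<^bsub>B\<^esub> a \<otimes>\<^bsub>B\<^esub> \<Delta> \<in> P" "\<Delta> \<otimes>\<^bsub>B\<^esub> a \<otimes>\<^bsub>B\<^esub> inv\<^bsub>B\<^esub> \<Delta> \<in> P" using a by (rule Delta_conj)+
  assume ne: "a \<noteq> \<one>\<^bsub>B\<^esub>"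
  show "\<exists>s\<in>P. s \<noteq> \<one>\<^bsub>B\<^esub> \<and> s \<preceq> a \<and> s \<preceq> \<Delta>"
  proof -
    obtain i b where i: "i \<in> {1..<n}" "b \<in> P" "a = sigma n i \<otimes>\<^bsub>B\<^esub> b" using pos_casesE[OF a] ne by blast
    then show ?thesis
      using sigma_pos[OF i(1)] sigma_ne_one[OF i(1)] sigma_le_Delta[OF i(1)]
      by (intro bexI[of _ "sigma n i"]) simp_all
  qed
  show "\<exists>s\<in>P. s \<noteq> \<one>\<^bsub>B\<^esub> \<and> a \<otimes>\<^bsub>B\<^esub> inv\<^bsub>B\<^esub> s \<in> P \<and> \<Delta> \<otimes>\<^bsub>B\<^esub> inv\<^bsub>B\<^esub> s \<in> P"
  proof -
    obtain i b where i: "i \<in> {1..<n}" "b \<in> P" "a = b \<otimes>\<^bsub>B\<^esub> sigma n i" using pos_last_casesE[OF a] ne by blast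
    then show ?thesis
      using sigma_pos[OF i(1)] sigma_ne_one[OF i(1)] sigma_right_divides_Delta[OF i(1)]
      by (intro bexI[of _ "sigma n i"]) simp_all
  qed
qed (rule braid_glb_ex braid_lub_ex; assumption)+

end

section \<open>Left and right rigid braids\<close>

lemma opposite_opposite: "opposite (opposite G) = (G :: 'a monoid)"
  by (simp add: opposite_def)

context braids begin

sublocale op: garside_group "opposite (braid_group n)" "positive_braids n" braid_len "Delta n"
  by (rule opposite_garside_group)

lemma lprod_eq: "lprod xs = braid_prod n xs"
  by (simp add: lprod_def braid_prod_def)

lemma op_lprod: "set xs \<subseteq> carrier B \<Longrightarrow> op.lprod xs = braid_prod n (rev xs)"
proof (induction xs)
  case (Cons x xs)
  then show ?case by (simp add: lprod_append flip: lprod_eq)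
qed (simp add: braid_prod_def)

text \<open>The meet in an order is by definition a chosen greatest lower bound; that one exists is the lattice property of
the braid group, and antisymmetry makes the choice unique.\<close>

lemma is_glb_iff_left_gcd:
  assumes "a \<in> carrier B" "b \<in> carrier B"
  shows "is_glb d a b \<longleftrightarrow> d = left_gcd n a b"
proof -
  have "greatest (left_order n) e (Lower (left_order n) {a, b}) \<longleftrightarrow> is_glb e a b" for e
    using assms by (auto simp: greatest_def Lower_def left_order_def is_glb_def)
  then have "left_gcd n a b = (SOME e. is_glb e a b)"
    by (simp add: left_gcd_def meet_def inf_def)
  then have "is_glb (left_gcd n a b) a b" using someI_ex[OF glb_ex[OF assms]] by simp
  then show ?thesis using is_glb_unique by blast
qed

lemma op_is_glb_iff_right_gcd:
  assumes "a \<in> carrier B" "b \<in> carrier B"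
  shows "op.is_glb d a b \<longleftrightarrow> d = right_gcd n a b"
proof -
  have "greatest (right_order n) e (Lower (right_order n) {a, b}) \<longleftrightarrow> op.is_glb e a b" for e
  proof -
    have le: "inv\<^bsub>opposite B\<^esub> u \<otimes>\<^bsub>opposite B\<^esub> v = v \<otimes>\<^bsub>B\<^esub> inv\<^bsub>B\<^esub> u" if "u \<in> carrier B" for u v
      using that by simp
    have low: "Lower (right_order n) {a, b} =
        {l \<in> carrier B. a \<otimes>\<^bsub>B\<^esub> inv\<^bsub>B\<^esub> l \<in> P \<and> b \<otimes>\<^bsub>B\<^esub> inv\<^bsub>B\<^esub> l \<in> P}"
      using assms unfolding Lower_def right_order_def gorder.simps partial_object.simps eq_object.simps
      by blast
    have "greatest (right_order n) e {l \<in> carrier B. a \<otimes>\<^bsub>B\<^esub> inv\<^bsub>B\<^esub> l \<in> P \<and> b \<otimes>\<^bsub>B\<^esub> inv\<^bsub>B\<^esub> l \<in> P} \<longleftrightarrow>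
        e \<in> carrier B \<and> a \<otimes>\<^bsub>B\<^esub> inv\<^bsub>B\<^esub> e \<in> P \<and> b \<otimes>\<^bsub>B\<^esub> inv\<^bsub>B\<^esub> e \<in> P \<and>
        (\<forall>l\<in>carrier B. a \<otimes>\<^bsub>B\<^esub> inv\<^bsub>B\<^esub> l \<in> P \<longrightarrow> b \<otimes>\<^bsub>B\<^esub> inv\<^bsub>B\<^esub> l \<in> P \<longrightarrow> e \<otimes>\<^bsub>B\<^esub> inv\<^bsub>B\<^esub> l \<in> P)"
      unfolding greatest_def right_order_def gorder.simps partial_object.simps eq_object.simps
      by blast
    also have "\<dots> \<longleftrightarrow> op.is_glb e a b"
      unfolding op.is_glb_def opposite_simps(1) using le by (metis (no_types, lifting))
    finally show ?thesis unfolding low .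
  qed
  then have "right_gcd n a b = (SOME e. op.is_glb e a b)"
    by (simp add: right_gcd_def meet_def inf_def)
  then have "op.is_glb (right_gcd n a b) a b" using someI_ex[OF op.glb_ex[of a b]] assms by simp
  then show ?thesis using op.is_glb_unique by blast
qed

lemma is_left_nf_iff_nf: "is_left_nf n x p xs \<longleftrightarrow> nf x p xs"
proof -
  have "xs ! i = left_gcd n (braid_prod n (drop i xs)) \<Delta> \<longleftrightarrow> is_glb (xs ! i) (braid_prod n (drop i xs)) \<Delta>"
    if "set xs \<subseteq> carrier B" for i
  proof -
    have "set (drop i xs) \<subseteq> carrier B" using that by (blast dest: in_set_dropD)
    then show ?thesis using is_glb_iff_left_gcd[of "braid_prod n (drop i xs)" \<Delta>] lprod_closed
      by (simp flip: lprod_eq)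
  qed
  then show ?thesis
    unfolding is_left_nf_def nf_def lprod_eq Delta_pow_def by blast
qed

text \<open>Reversing the list turns the prefixes in the definition of the right normal form into suffixes.\<close>

lemma is_right_nf_iff_op_nf: "is_right_nf n x ys p \<longleftrightarrow> op.nf x p (rev ys)"
proof (cases "set ys \<subseteq> carrier B")
  case ys: True
  have sub: "set (take i ys) \<subseteq> carrier B" for i using ys by (blast dest: in_set_takeD)
  have gcd: "y = right_gcd n (braid_prod n (take i ys)) \<Delta> \<longleftrightarrow>
      op.is_glb y (braid_prod n (take i ys)) \<Delta>" for y i
    using op_is_glb_iff_right_gcd[of "braid_prod n (take i ys)" \<Delta>] lprod_closed[OF sub[of i]]
    by (simp add: lprod_eq)
  have "(\<forall>i<length ys. Q (ys ! i) (take (Suc i) ys)) \<longleftrightarrow>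
      (\<forall>i<length (rev ys). Q (rev ys ! i) (rev (drop i (rev ys))))" for Q
  proof -
    have *: "rev ys ! i = ys ! (length ys - Suc i)"
      "rev (drop i (rev ys)) = take (Suc (length ys - Suc i)) ys" if "i < length ys" for i
      using that by (simp_all add: rev_nth drop_rev Suc_diff_Suc)
    show ?thesis
    proof
      assume "\<forall>i<length ys. Q (ys ! i) (take (Suc i) ys)"
      then show "\<forall>i<length (rev ys). Q (rev ys ! i) (rev (drop i (rev ys)))"
        using * by simp
    next
      assume H: "\<forall>i<length (rev ys). Q (rev ys ! i) (rev (drop i (rev ys)))"
      show "\<forall>i<length ys. Q (ys ! i) (take (Suc i) ys)"
      proof (intro allI impI)
        fix i assume i: "i < length ys"
        then have "length ys - Suc i < length ys" "length ys - Suc (length ys - Suc i) = i" by auto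
        then show "Q (ys ! i) (take (Suc i) ys)" using H[rule_format, of "length ys - Suc i"] * by simp
      qed
    qed
  qed
  note idx = this[of "\<lambda>y zs. op.is_glb y (braid_prod n zs) \<Delta> \<and> y \<noteq> \<one>\<^bsub>B\<^esub>"]
  have dr: "op.lprod (drop i (rev ys)) = braid_prod n (rev (drop i (rev ys)))" for i
    using ys set_drop_subset[of i "rev ys"] by (intro op_lprod) simp
  have all: "op.lprod (rev ys) = braid_prod n ys" using ys op_lprod[of "rev ys"] by simp
  show ?thesis
    unfolding is_right_nf_def op.nf_def gcd idx dr all Delta_pow_def using ys by simp
next
  case False
  then show ?thesis by (simp add: is_right_nf_def op.nf_def)
qed

lemma left_rigid_iff_rigid: "left_rigid n x \<longleftrightarrow> rigid x"
  unfolding left_rigid_def rigid_def is_left_nf_iff_nf tau_pow_def Delta_pow_def by simp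

lemma right_rigid_iff_op_rigid: "right_rigid n x \<longleftrightarrow> op.rigid x"
proof -
  have body: "is_right_nf n x ys p \<and> ys \<noteq> [] \<and>
      is_right_nf n (tau_pow n p (last ys) \<otimes>\<^bsub>B\<^esub> x) (tau_pow n p (last ys) # ys) p \<longleftrightarrow>
    op.nf x p (rev ys) \<and> rev ys \<noteq> [] \<and>
      op.nf (x \<otimes>\<^bsub>opposite B\<^esub> (\<Delta> [^]\<^bsub>opposite B\<^esub> p \<otimes>\<^bsub>opposite B\<^esub> hd (rev ys) \<otimes>\<^bsub>opposite B\<^esub>
        \<Delta> [^]\<^bsub>opposite B\<^esub> (- p))) p (rev ys @ [\<Delta> [^]\<^bsub>opposite B\<^esub> p \<otimes>\<^bsub>opposite B\<^esub> hd (rev ys)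
        \<otimes>\<^bsub>opposite B\<^esub> \<Delta> [^]\<^bsub>opposite B\<^esub> (- p)])" for ys p
  proof (cases "ys \<noteq> [] \<and> set ys \<subseteq> carrier B")
    case True
    then have "last ys \<in> carrier B" by auto
    then have "tau_pow n p (last ys) = \<Delta> [^]\<^bsub>opposite B\<^esub> p \<otimes>\<^bsub>opposite B\<^esub> hd (rev ys) \<otimes>\<^bsub>opposite B\<^esub>
        \<Delta> [^]\<^bsub>opposite B\<^esub> (- p)"
      by (simp add: tau_pow_def Delta_pow_def hd_rev m_assoc)
    then show ?thesis using True by (simp add: is_right_nf_iff_op_nf)
  next
    case False
    then show ?thesis by (auto simp: is_right_nf_def op.nf_def)
  qed
  show ?thesis
  proof
    assume "right_rigid n x"
    then show "op.rigid x" unfolding right_rigid_def op.rigid_def body by blast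
  next
    assume "op.rigid x"
    then obtain p zs where z: "op.nf x p (rev (rev zs)) \<and> rev (rev zs) \<noteq> [] \<and>
      op.nf (x \<otimes>\<^bsub>opposite B\<^esub> (\<Delta> [^]\<^bsub>opposite B\<^esub> p \<otimes>\<^bsub>opposite B\<^esub> hd (rev (rev zs)) \<otimes>\<^bsub>opposite B\<^esub>
        \<Delta> [^]\<^bsub>opposite B\<^esub> (- p))) p (rev (rev zs) @ [\<Delta> [^]\<^bsub>opposite B\<^esub> p \<otimes>\<^bsub>opposite B\<^esub> hd (rev (rev zs))
        \<otimes>\<^bsub>opposite B\<^esub> \<Delta> [^]\<^bsub>opposite B\<^esub> (- p)])"
      unfolding op.rigid_def rev_rev_ident by blast
    then show "right_rigid n x" unfolding right_rigid_def body[symmetric] by blast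
  qed
qed

lemma left_rigid_imp_conjugate_right_rigid:
  assumes "y \<in> carrier B" "left_rigid n y"
  shows "\<exists>z. conjugate n y z \<and> right_rigid n z"
  using rigid_conjugate_opposite_rigid[OF assms(1)] assms(2)
  unfolding conjugate_def left_rigid_iff_rigid right_rigid_iff_op_rigid by blast

text \<open>The abstract theorem for the opposite group; the opposite of the opposite group is the braid group
itself.\<close>

lemma right_rigid_imp_conjugate_left_rigid:
  assumes y: "y \<in> carrier B" and "right_rigid n y"
  shows "\<exists>z. conjugate n y z \<and> left_rigid n z"
proof -
  obtain v where v: "v \<in> carrier B" "rigid (v \<otimes>\<^bsub>B\<^esub> y \<otimes>\<^bsub>B\<^esub> inv\<^bsub>B\<^esub> v)"
    using op.rigid_conjugate_opposite_rigid[of y] assms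
    by (auto simp: opposite_opposite right_rigid_iff_op_rigid m_assoc)
  have "conjugate n y (v \<otimes>\<^bsub>B\<^esub> y \<otimes>\<^bsub>B\<^esub> inv\<^bsub>B\<^esub> v)"
    unfolding conjugate_def using v(1) by (intro bexI[of _ "inv\<^bsub>B\<^esub> v"]) simp_all
  then show ?thesis using v(2) unfolding left_rigid_iff_rigid by blast
qed

lemma conjugate_closed: "x \<in> carrier B \<Longrightarrow> conjugate n x y \<Longrightarrow> y \<in> carrier B"
  by (auto simp: conjugate_def)

lemma conjugate_trans:
  assumes "x \<in> carrier B" "conjugate n x y" "conjugate n y z"
  shows "conjugate n x z"
proof -
  obtain c d where c: "c \<in> carrier B" "y = inv\<^bsub>B\<^esub> c \<otimes>\<^bsub>B\<^esub> x \<otimes>\<^bsub>B\<^esub> c"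
    and d: "d \<in> carrier B" "z = inv\<^bsub>B\<^esub> d \<otimes>\<^bsub>B\<^esub> y \<otimes>\<^bsub>B\<^esub> d"
    using assms(2,3) unfolding conjugate_def by blast
  then show ?thesis
    unfolding conjugate_def using assms(1)
    by (intro bexI[of _ "c \<otimes>\<^bsub>B\<^esub> d"]) (simp_all add: inv_mult_group m_assoc)
qed

end

theorem theorem1p2:
  fixes n :: nat and x :: braid
  assumes "x \<in> carrier (braid_group n)"
    and "canonical_length n x > 1"
  shows "(\<exists>y. conjugate n x y \<and> left_rigid n y) \<longleftrightarrow> (\<exists>y. conjugate n x y \<and> right_rigid n y)"
proof -
  interpret braids n .
  show ?thesis
    using left_rigid_imp_conjugate_right_rigid right_rigid_imp_conjugate_left_rigid
      conjugate_closed[OF assms(1)] conjugate_trans[OF assms(1)] by blast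
qed

end
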